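(* Let $t>0$ and, for each $x\in\mathbb{R}$, let $M^x=\{M^x_s\}_{0\le s\le t}$ be a process identical in law with $$\sqrt{(\beta^x_s)^2+(B^2_s)^2+(B^3_s)^2},\quad 0\le s\le t,$$ where $\beta^x=\{\beta^x_s\}_{0\le s\le t}$ is a one-dimensional Brownian bridge from $0$ to $x$ over $[0,t]$ and $(B^2,B^3)$ is a standard two-dimensional Brownian motion started at the origin, independent of $\beta^x$. Then for every $x\in\mathbb{R}$ and every nonnegative measurable function $F$ on $C([0,t];\mathbb{R})$, $$\mathbb{E}\bigl[F(M^x)\bigr]=\mathbb{E}\bigl[F(M^0)\,\big|\,M^0_t\ge |x|\bigr].$$
   Context: The Brownian bridge from $0$ to $x$ over $[0,t]$ is the continuous Gaussian process with mean $\frac{x}{t}s$ and covariance function $\frac{s_1(t-s_2)}{t}$ for $0\le s_1\le s_2\le t$. A measurable function on $C([0,t];\mathbb{R})$ is a function with values in the extended real line that is Borel-measurable with respect to the topology of uniform convergence. The conditional expectation on the right is elementary conditioning on the event $\{M^0_t\ge|x|\}$, which has positive probability. *)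

theory Defs
  imports "HOL-Probability.Probability"
begin

text \<open>
  \<open>C([0,t]; \<real>)\<close> with the uniform metric. Elements of \<^const>\<open>cfunspace\<close> are extensional,
  i.e. \<^const>\<open>undefined\<close> outside \<open>{0..t}\<close>.
\<close>

definition path_space :: "real \<Rightarrow> (real \<Rightarrow> real) metric" where
  "path_space t = cfunspace (top_of_set {0..t}) euclidean_metric"

definition path_borel :: "real \<Rightarrow> (real \<Rightarrow> real) measure" where
  "path_borel t = sigma (mspace (path_space t)) {U. openin (mtopology_of (path_space t)) U}"

text \<open>
  A process over \<open>{0..t}\<close> is a family \<open>X s \<omega>\<close>, of which only the values at \<open>s \<in> {0..t}\<close> matter.
\<close>

definition sample_path :: "real \<Rightarrow> (real \<Rightarrow> 'a \<Rightarrow> real) \<Rightarrow> 'a \<Rightarrow> real \<Rightarrow> real" where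
  "sample_path t X \<omega> = (\<lambda>s\<in>{0..t}. X s \<omega>)"

definition continuous_process :: "'a measure \<Rightarrow> real \<Rightarrow> (real \<Rightarrow> 'a \<Rightarrow> real) \<Rightarrow> bool" where
  "continuous_process P t X \<longleftrightarrow>
     prob_space P \<and>
     (\<forall>s\<in>{0..t}. X s \<in> borel_measurable P) \<and>
     (\<forall>\<omega>\<in>space P. continuous_on {0..t} (\<lambda>s. X s \<omega>))"

text \<open>
  The law on path space. It is meaningful for every \<^const>\<open>continuous_process\<close>: the Borel sets of
  the separable space \<open>C([0,t]; \<real>)\<close> are generated by the evaluations, so \<^term>\<open>sample_path t X\<close> is
  measurable.
\<close>

definition path_law :: "'a measure \<Rightarrow> real \<Rightarrow> (real \<Rightarrow> 'a \<Rightarrow> real) \<Rightarrow> (real \<Rightarrow> real) measure" where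
  "path_law P t X = distr P (path_borel t) (sample_path t X)"

text \<open>
  The degenerate case \<open>\<sigma> = 0\<close> has to be split off, since \<^term>\<open>normal_density \<mu> 0\<close> is zero.
\<close>

definition gaussian_variable :: "'a measure \<Rightarrow> ('a \<Rightarrow> real) \<Rightarrow> bool" where
  "gaussian_variable P Y \<longleftrightarrow>
     Y \<in> borel_measurable P \<and>
     (\<exists>\<mu> \<sigma>. 0 \<le> \<sigma> \<and>
        distr P borel Y =
          (if \<sigma> = 0 then return borel \<mu> else density lborel (normal_density \<mu> \<sigma>)))"

definition gaussian_process :: "'a measure \<Rightarrow> real \<Rightarrow> (real \<Rightarrow> 'a \<Rightarrow> real) \<Rightarrow> bool" where
  "gaussian_process P t X \<longleftrightarrow>
     (\<forall>J (c :: real \<Rightarrow> real). finite J \<and> J \<subseteq> {0..t} \<longrightarrow> gaussian_variable P (\<lambda>\<omega>. \<Sum>s\<in>J. c s * X s \<omega>))"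

definition covariance :: "'a measure \<Rightarrow> ('a \<Rightarrow> real) \<Rightarrow> ('a \<Rightarrow> real) \<Rightarrow> real" where
  "covariance P Y Z =
     integral\<^sup>L P (\<lambda>\<omega>. (Y \<omega> - integral\<^sup>L P Y) * (Z \<omega> - integral\<^sup>L P Z))"

definition brownian_bridge ::
    "'a measure \<Rightarrow> real \<Rightarrow> real \<Rightarrow> (real \<Rightarrow> 'a \<Rightarrow> real) \<Rightarrow> bool" where
  "brownian_bridge P t x \<beta> \<longleftrightarrow>
     continuous_process P t \<beta> \<and>
     gaussian_process P t \<beta> \<and>
     (\<forall>s\<in>{0..t}. integral\<^sup>L P (\<beta> s) = x / t * s) \<and>
     (\<forall>s\<^sub>1 s\<^sub>2. 0 \<le> s\<^sub>1 \<and> s\<^sub>1 \<le> s\<^sub>2 \<and> s\<^sub>2 \<le> t \<longrightarrow>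
        covariance P (\<beta> s\<^sub>1) (\<beta> s\<^sub>2) = s\<^sub>1 * (t - s\<^sub>2) / t)"

definition brownian_motion :: "'a measure \<Rightarrow> real \<Rightarrow> (real \<Rightarrow> 'a \<Rightarrow> real) \<Rightarrow> bool" where
  "brownian_motion P t B \<longleftrightarrow>
     continuous_process P t B \<and>
     (AE \<omega> in P. B 0 \<omega> = 0) \<and>
     (\<forall>r s. 0 \<le> r \<and> r < s \<and> s \<le> t \<longrightarrow>
        distributed P lborel (\<lambda>\<omega>. B s \<omega> - B r \<omega>) (normal_density 0 (sqrt (s - r)))) \<and>
     (\<forall>(n::nat) \<tau>. \<tau> ` {..n} \<subseteq> {0..t} \<and> mono_on {..n} \<tau> \<longrightarrow>
        prob_space.indep_vars P (\<lambda>_. borel) (\<lambda>i \<omega>. B (\<tau> (Suc i)) \<omega> - B (\<tau> i) \<omega>) {..<n})"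

definition brownian_motion_2d ::
    "'a measure \<Rightarrow> real \<Rightarrow> (real \<Rightarrow> 'a \<Rightarrow> real) \<Rightarrow> (real \<Rightarrow> 'a \<Rightarrow> real) \<Rightarrow> bool" where
  "brownian_motion_2d P t B\<^sub>2 B\<^sub>3 \<longleftrightarrow>
     brownian_motion P t B\<^sub>2 \<and> brownian_motion P t B\<^sub>3 \<and>
     prob_space.indep_var P
       (PiM {0..t} (\<lambda>_. borel)) (sample_path t B\<^sub>2) (PiM {0..t} (\<lambda>_. borel)) (sample_path t B\<^sub>3)"

text \<open>
  Independence of the process \<open>X\<close> from the pair \<open>(Y, Z)\<close>, through the generated
  \<open>\<sigma>\<close>-algebras: \<open>indep_var\<close> requires both random elements to have the same type.
\<close>

definition indep_of_pair ::
    "'a measure \<Rightarrow> real \<Rightarrow> (real \<Rightarrow> 'a \<Rightarrow> real) \<Rightarrow>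
       (real \<Rightarrow> 'a \<Rightarrow> real) \<Rightarrow> (real \<Rightarrow> 'a \<Rightarrow> real) \<Rightarrow> bool" where
  "indep_of_pair P t X Y Z \<longleftrightarrow>
     prob_space.indep_set P
       (sets (vimage_algebra (space P) (sample_path t X) (PiM {0..t} (\<lambda>_. borel))))
       (sets (vimage_algebra (space P) (\<lambda>\<omega>. (sample_path t Y \<omega>, sample_path t Z \<omega>))
         (PiM {0..t} (\<lambda>_. borel) \<Otimes>\<^sub>M PiM {0..t} (\<lambda>_. borel))))"

text \<open>
  \<open>E[Y | A] = E[Y; A] / P(A)\<close> for an event \<open>A\<close> of positive probability; \<^const>\<open>uniform_measure\<close>
  is \<open>P\<close> conditioned on \<open>A\<close>. When \<open>P(A) = 0\<close> the value is \<open>0\<close>.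
\<close>

definition cond_nn_expectation :: "'a measure \<Rightarrow> ('a \<Rightarrow> ennreal) \<Rightarrow> 'a set \<Rightarrow> ennreal" where
  "cond_nn_expectation P Y A = (\<integral>\<^sup>+ \<omega>. Y \<omega> \<partial>uniform_measure P A)"

end

theory Submission
  imports Defs
begin

text \<open>
  Write \<open>b\<close> for a three-dimensional Brownian bridge from \<open>0\<close> to \<open>0\<close> over \<open>[0,t]\<close> and \<open>Z\<^sub>2, Z\<^sub>3\<close> for independent normal
  variables of variance \<open>t\<close>, independent of \<open>b\<close>. Comparing covariances, \<open>M\<^sup>x\<close> has the law of
  the norm of \<open>b + (s / t) (x, Z\<^sub>2, Z\<^sub>3)\<close>. Since the law of \<open>b\<close> is invariant under rotations, the law of
  \<open>|b + (s / t) v|\<close> depends only on \<open>|v|\<close>, which is also the value of that process at time \<open>t\<close>. So all the \<open>M\<^sup>x\<close> are mixtures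
  of one and the same family of laws, indexed by the endpoint \<open>r\<close>, and \<open>x\<close> only affects the law of
  that endpoint: its square is \<open>x\<^sup>2 + Z\<^sub>2\<^sup>2 + Z\<^sub>3\<^sup>2\<close>. As \<open>Z\<^sub>2\<^sup>2 + Z\<^sub>3\<^sup>2\<close> is exponentially distributed, lack of memory says
  that this is the law of \<open>Z\<^sub>2\<^sup>2 + Z\<^sub>3\<^sup>2\<close> conditioned to be at least \<open>x\<^sup>2\<close>, that is, the law of the squared endpoint of
  \<open>M\<^sup>0\<close> given \<open>M\<^sup>0\<^sub>t \<ge> |x|\<close>.

  The argument is carried out on cylinder sets, which determine measures on path space (\<open>path_measure_eqI\<close>). Equality
  of Gaussian laws is read off from characteristic functions (\<open>vector_char_unique\<close>), for the decomposition in
  \<open>bridge_with_planar_motion_box\<close> and for the rotation invariance in \<open>shifted_norm_box_rotate\<close>. The lack of memory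
  is \<open>planar_gaussian_memoryless\<close>.
\<close>

section \<open>Measurability on path space\<close>

lemma mspace_path_space:
  "mspace (path_space t) = {f \<in> extensional {0..t}. continuous_on {0..t} f}"
  unfolding path_space_def
  by (subst compactin_mspace_cfunspace) auto

lemma mdist_path_space_le:
  assumes "f \<in> mspace (path_space t)" "g \<in> mspace (path_space t)" "0 \<le> t"
  shows "mdist (path_space t) f g \<le> a \<longleftrightarrow> (\<forall>s\<in>{0..t}. \<bar>f s - g s\<bar> \<le> a)"
  using assms unfolding path_space_def
  by (subst cfunspace_mdist_le) (auto simp: dist_real_def)

lemma openin_path_space_iff:
  "openin (mtopology_of (path_space t)) U \<longleftrightarrow> U \<subseteq> mspace (path_space t) \<and>
     (\<forall>f\<in>U. \<exists>e>0. \<forall>g\<in>mspace (path_space t). mdist (path_space t) f g < e \<longrightarrow> g \<in> U)"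
proof -
  interpret Metric_space "mspace (path_space t)" "mdist (path_space t)" by simp
  show ?thesis
    unfolding mtopology_of_def openin_mtopology by (fastforce simp: subset_iff)
qed

lemma space_path_borel: "space (path_borel t) = mspace (path_space t)"
  and sets_path_borel: 
    "sets (path_borel t) = sigma_sets (mspace (path_space t)) {U. openin (mtopology_of (path_space t)) U}"
proof -
  have "{U. openin (mtopology_of (path_space t)) U} \<subseteq> Pow (mspace (path_space t))"
    by (auto simp: openin_path_space_iff)
  then show "space (path_borel t) = mspace (path_space t)"
   "sets (path_borel t) = sigma_sets (mspace (path_space t)) {U. openin (mtopology_of (path_space t)) U}"
    unfolding path_borel_def by auto
qed

lemma measurable_path_eval:
  assumes s: "s \<in> {0..t}"
  shows "(\<lambda>f. f s) \<in> borel_measurable (path_borel t)"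
proof (rule borel_measurableI)
  fix V :: "real set" assume "open V"
  have "openin (mtopology_of (path_space t)) {f \<in> mspace (path_space t). f s \<in> V}"
    unfolding openin_path_space_iff
  proof safe
    fix f assume f: "f \<in> mspace (path_space t)" "f s \<in> V"
    then obtain e where e: "e > 0" "ball (f s) e \<subseteq> V" using \<open>open V\<close> openE by blast
    have "g s \<in> V" if g: "g \<in> mspace (path_space t)" "mdist (path_space t) f g < e" for g
    proof -
      have "\<bar>f s - g s\<bar> \<le> mdist (path_space t) f g"
        using s mdist_path_space_le[OF f(1) g(1), of "mdist (path_space t) f g"] by auto
      with e g show ?thesis by (auto simp: dist_real_def subset_iff)
    qed
    with e show "\<exists>e>0. \<forall>g\<in>mspace (path_space t). mdist (path_space t) f g < e \<longrightarrow>
        g \<in> {f \<in> mspace (path_space t). f s \<in> V}" by auto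
  qed
  then show "(\<lambda>f. f s) -` V \<inter> space (path_borel t) \<in> sets (path_borel t)"
    unfolding sets_path_borel space_path_borel
    by (intro sigma_sets.Basic) (auto elim: back_subst[where P="openin _"])
qed

lemma dense_subset_le:
  fixes f g :: "real \<Rightarrow> real"
  assumes "continuous_on S f" "continuous_on S g" "D \<subseteq> S" "S \<subseteq> closure D"
    and D: "\<And>s. s \<in> D \<Longrightarrow> \<bar>f s - g s\<bar> \<le> c" and "s \<in> S"
  shows "\<bar>f s - g s\<bar> \<le> c"
proof -
  have "closedin (top_of_set S) {s\<in>S. \<bar>f s - g s\<bar> \<in> {..c}}"
    using assms by (intro continuous_closedin_preimage[unfolded vimage_def Int_def mem_Collect_eq]
        continuous_on_rabs continuous_on_diff) auto
  then obtain T where "closed T" and T: "{s\<in>S. \<bar>f s - g s\<bar> \<in> {..c}} = S \<inter> T"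
    unfolding closedin_closed by blast
  have "D \<subseteq> {s\<in>S. \<bar>f s - g s\<bar> \<in> {..c}}" using assms by auto
  then have "D \<subseteq> T" unfolding T by simp
  then have "closure D \<subseteq> T" using \<open>closed T\<close> by (rule closure_minimal)
  then have "s \<in> S \<inter> T" using assms by auto
  then show ?thesis unfolding T[symmetric] by simp
qed

text \<open>
  On \<open>C([0,t]; \<real>)\<close> the Borel sets of the uniform topology are the traces of the product
  \<open>\<sigma>\<close>-algebra. Evaluations are continuous, which is one inclusion. The other is a form of separability: every
  open set is a countable union of sets of paths that stay, on a countable dense set of times, within a fixed
  distance of a step function with values on a grid. These sets are cylinder measurable, and uniform continuity
  of a path shows that they are small enough to fit between the path and any open set around it.
\<close>

lemma sets_path_borel_PiM:
  assumes "0 \<le> t"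
  shows "sets (path_borel t) = sets (restrict_space (PiM {0..t} (\<lambda>_. borel)) (mspace (path_space t)))"
    (is "_ = sets ?R")
proof
  have spR: "space ?R = mspace (path_space t)"
    by (auto simp: space_restrict_space space_PiM mspace_path_space extensional_def PiE_def)
  have "(\<lambda>f. f) \<in> path_borel t \<rightarrow>\<^sub>M ?R"
  proof (rule measurable_restrict_space2)
    show "(\<lambda>f. f) \<in> path_borel t \<rightarrow>\<^sub>M PiM {0..t} (\<lambda>_. borel)"
      by (rule measurable_PiM_single')
         (auto simp: space_path_borel mspace_path_space measurable_path_eval extensional_def PiE_def)
  qed (auto simp: space_path_borel)
  from measurable_sets[OF this] show "sets ?R \<subseteq> sets (path_borel t)"
    using spR sets.sets_into_space[of _ ?R]
    by (fastforce simp: space_path_borel Int_absorb2)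
  have ev[measurable]: "(\<lambda>f. f s) \<in> borel_measurable ?R" if "s \<in> {0..t}" for s
    using that by (intro measurable_restrict_space1) measurable
  obtain D where D: "countable D" "D \<subseteq> {0..t}" "{0..t} \<subseteq> closure D"
    using separable[of "{0..t}"] by blast
  \<comment> \<open>Step functions on a mesh of width \<open>1/n\<close>, values in the multiples of \<open>1/(m+1)\<close>, listed by \<open>zs\<close>.\<close>
  define S where "S = (\<lambda>(n::nat, m::nat, zs :: int list).
    {f \<in> space ?R. \<forall>s\<in>D. \<bar>f s - zs ! nat \<lfloor>real n * s\<rfloor> / Suc m\<bar> \<le> 1 / Suc m})"
  have S_sets: "S i \<in> sets ?R" for i
  proof -
    obtain n m zs where i: "i = (n, m, zs)" by (cases i) auto
    have "{f \<in> space ?R. \<bar>f s - zs ! nat \<lfloor>real n * s\<rfloor> / Suc m\<bar> \<le> 1 / Suc m} \<in> sets ?R" if "s \<in> D" for s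
    proof -
      have [measurable]: "s \<in> {0..t}" using that D by auto
      show ?thesis by measurable
    qed
    then have "{f \<in> space ?R. \<forall>s\<in>D. \<bar>f s - zs ! nat \<lfloor>real n * s\<rfloor> / Suc m\<bar> \<le> 1 / Suc m} \<in> sets ?R"
      by (rule sets.sets_Collect_countable_All'[OF _ D(1)])
    then show ?thesis by (simp add: S_def i)
  qed
  have "U \<in> sets ?R" if U: "openin (mtopology_of (path_space t)) U" for U
  proof -
    have "U = (\<Union>i\<in>{i. S i \<subseteq> U}. S i)"
    proof (intro equalityI subsetI)
      fix f assume fU: "f \<in> U"
      from U fU have f: "f \<in> mspace (path_space t)" by (auto simp: openin_path_space_iff)
      obtain e where e: "e > 0" "\<And>g. g \<in> mspace (path_space t) \<Longrightarrow> mdist (path_space t) f g < e \<Longrightarrow> g \<in> U"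
        using U fU unfolding openin_path_space_iff by metis
      obtain m :: nat where m: "1 / Suc m < e / 3"
        using nat_approx_posE[of "e/3"] e by auto
      define \<delta> where "\<delta> = 1 / Suc m"
      have \<delta>: "\<delta> > 0" "3 * \<delta> < e" using m by (auto simp: \<delta>_def)
      have "uniformly_continuous_on {0..t} f"
        using f by (intro compact_uniformly_continuous) (auto simp: mspace_path_space)
      then obtain d where d: "d > 0"
        "\<And>s s'. s \<in> {0..t} \<Longrightarrow> s' \<in> {0..t} \<Longrightarrow> \<bar>s' - s\<bar> < d \<Longrightarrow> \<bar>f s' - f s\<bar> < \<delta> / 2"
        unfolding uniformly_continuous_on_def dist_real_def using \<delta> by (metis half_gt_zero)
      obtain n0 :: nat where n0: "1 / Suc n0 < d" using nat_approx_posE[of d] d by auto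
      define n where "n = Suc n0"
      have n: "1 / n < d" "n > 0" using n0 by (auto simp: n_def)
      define N where "N = Suc (nat \<lfloor>real n * t\<rfloor>)"
      \<comment> \<open>Adding \<open>1/2\<close> before taking the floor rounds to the nearest grid value.\<close>
      define zs where "zs = map (\<lambda>k. \<lfloor>f (k / n) / \<delta> + 1/2\<rfloor>) [0..<N]"
      have "\<bar>f s - zs ! nat \<lfloor>real n * s\<rfloor> / Suc m\<bar> \<le> 1 / Suc m" if s: "s \<in> {0..t}" for s
      proof -
        define k where "k = nat \<lfloor>real n * s\<rfloor>"
        have k: "real k \<le> n * s" "n * s < k + 1" 
        proof -
          have "real k = \<lfloor>real n * s\<rfloor>" unfolding k_def using s by simp
          then show "real k \<le> n * s" "n * s < k + 1" by linarith+
        qed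
        have "k < N" unfolding k_def N_def using s
          by (auto simp: less_Suc_eq_le intro!: nat_mono floor_mono mult_left_mono)
        have "real k / n \<le> s" "s < k / n + 1 / n" using k n by (auto simp: field_simps)
        then have "\<bar>f s - f (k/n)\<bar> < \<delta> / 2" using n s by (intro d(2)) auto
        moreover have "\<bar>f (k/n) - zs ! k * \<delta>\<bar> \<le> \<delta> / 2"
        proof -
          have "zs ! k = \<lfloor>f (k/n) / \<delta> + 1/2\<rfloor>" using \<open>k < N\<close> by (simp add: zs_def)
          then have "\<bar>f (k/n) / \<delta> - zs ! k\<bar> \<le> 1/2" by linarith
          then have "\<bar>f (k/n) / \<delta> - zs ! k\<bar> * \<delta> \<le> 1/2 * \<delta>" using \<delta>(1) by (intro mult_right_mono) auto
          also have "\<bar>f (k/n) / \<delta> - zs ! k\<bar> * \<delta> = \<bar>(f (k/n) / \<delta> - zs ! k) * \<delta>\<bar>" 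
            using \<delta>(1) by (simp add: abs_mult)
          also have "(f (k/n) / \<delta> - zs ! k) * \<delta> = f (k/n) - zs ! k * \<delta>" using \<delta>(1) by (simp add: field_simps)
          finally show ?thesis by simp
        qed
        ultimately have "\<bar>f s - zs ! k * \<delta>\<bar> \<le> \<delta>" by linarith
        then show ?thesis by (simp add: k_def \<delta>_def)
      qed note zs = this
      then have "f \<in> S (n, m, zs)" using D f spR by (auto simp: S_def)
      moreover have "S (n, m, zs) \<subseteq> U"
      proof
        fix g assume "g \<in> S (n, m, zs)"
        then have g: "g \<in> mspace (path_space t)" 
          "\<And>s. s \<in> D \<Longrightarrow> \<bar>g s - zs ! nat \<lfloor>real n * s\<rfloor> / Suc m\<bar> \<le> 1 / Suc m"
          by (auto simp: S_def spR)
        have "\<bar>f s - g s\<bar> \<le> 2 * \<delta>" if "s \<in> D" for s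
          using g(2)[OF that] zs[of s] that D(2) unfolding \<delta>_def by (auto simp del: of_nat_Suc)
        then have "\<bar>f s - g s\<bar> \<le> 2 * \<delta>" if "s \<in> {0..t}" for s
          using dense_subset_le[of "{0..t}" f g D "2*\<delta>" s] D that f g(1) by (auto simp: mspace_path_space)
        then have "mdist (path_space t) f g \<le> 2 * \<delta>"
          using f g assms by (simp add: mdist_path_space_le)
        then show "g \<in> U" using e(2) g(1) \<delta> by auto
      qed
      ultimately show "f \<in> (\<Union>i\<in>{i. S i \<subseteq> U}. S i)" by auto
    qed auto
    also have "\<dots> \<in> sets ?R" using S_sets by (intro sets.countable_UN') auto
    finally show ?thesis .
  qed
  then show "sets (path_borel t) \<subseteq> sets ?R"
    unfolding sets_path_borel by (subst spR[symmetric], intro sets.sigma_sets_subset) auto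
qed

lemma measurable_sample_path:
  assumes "continuous_process P t X" "0 \<le> t"
  shows "sample_path t X \<in> P \<rightarrow>\<^sub>M path_borel t"
proof -
  have "sample_path t X \<in> P \<rightarrow>\<^sub>M restrict_space (PiM {0..t} (\<lambda>_. borel)) (mspace (path_space t))"
  proof (rule measurable_restrict_space2)
    show "sample_path t X \<in> P \<rightarrow>\<^sub>M PiM {0..t} (\<lambda>_. borel)"
      unfolding sample_path_def using assms by (intro measurable_restrict) (auto simp: continuous_process_def)
    show "sample_path t X \<in> space P \<rightarrow> mspace (path_space t)"
    proof
      fix \<omega> assume "\<omega> \<in> space P"
      then have "continuous_on {0..t} (\<lambda>s. X s \<omega>)" using assms by (simp add: continuous_process_def)
      then have "continuous_on {0..t} (\<lambda>s\<in>{0..t}. X s \<omega>)" by (rule continuous_on_eq) simp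
      then show "sample_path t X \<omega> \<in> mspace (path_space t)"
        by (simp add: sample_path_def mspace_path_space)
    qed
  qed
  then show ?thesis using sets_path_borel_PiM[OF assms(2)] by (simp cong: measurable_cong_sets)
qed

text \<open>
  Finite-dimensional distributions determine a finite measure on path space. It is enough to look at
  finite sets of times containing the endpoint \<open>t\<close>, because adding \<open>t\<close> with the constraint \<open>UNIV\<close> changes nothing;
  the conditioning event concerns that endpoint.
\<close>

lemma path_measure_eqI:
  assumes t: "0 \<le> t" and [measurable_cong]: "sets \<mu> = sets (path_borel t)" "sets \<nu> = sets (path_borel t)"
    and fin: "finite_measure \<mu>"
    and eq: "\<And>J A. finite J \<Longrightarrow> J \<subseteq> {0..t} \<Longrightarrow> t \<in> J \<Longrightarrow> (\<And>s. A s \<in> sets borel) \<Longrightarrow>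
      emeasure \<mu> {f \<in> space (path_borel t). \<forall>s\<in>J. f s \<in> A s} =
      emeasure \<nu> {f \<in> space (path_borel t). \<forall>s\<in>J. f s \<in> A s}"
  shows "\<mu> = \<nu>"
proof (rule measure_eqI)
  let ?PiM = "PiM {0..t} (\<lambda>_. borel :: real measure)"
  have [simp]: "space \<mu> = space (path_borel t)" "space \<nu> = space (path_borel t)"
    using assms sets_eq_imp_space_eq by blast+
  have [measurable]: "(\<lambda>f. f) \<in> path_borel t \<rightarrow>\<^sub>M ?PiM"
      by (rule measurable_PiM_single')
         (auto simp: space_path_borel mspace_path_space measurable_path_eval extensional_def PiE_def)
  have *: "distr \<mu> ?PiM (\<lambda>f. f) = distr \<nu> ?PiM (\<lambda>f. f)"
  proof (rule measure_eqI_PiM_infinite)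
    fix A J assume J: "finite J" "J \<subseteq> {0..t}" "\<And>i. i \<in> J \<Longrightarrow> A i \<in> sets (borel :: real measure)"
    define A' where "A' s = (if s \<in> J then A s else UNIV)" for s
    have [measurable]: "A' s \<in> sets borel" for s using J by (auto simp: A'_def)
    have "(\<lambda>f. f) -` prod_emb {0..t} (\<lambda>_. borel) J (Pi\<^sub>E J A) \<inter> space (path_borel t)
        = {f \<in> space (path_borel t). \<forall>s\<in>insert t J. f s \<in> A' s}"
      using J by (auto simp: prod_emb_def A'_def space_path_borel mspace_path_space PiE_iff extensional_def
          split: if_splits)
    with eq[of "insert t J" A'] t J show "emeasure (distr \<mu> ?PiM (\<lambda>f. f)) (prod_emb {0..t} (\<lambda>_. borel) J (Pi\<^sub>E J A))
       = emeasure (distr \<nu> ?PiM (\<lambda>f. f)) (prod_emb {0..t} (\<lambda>_. borel) J (Pi\<^sub>E J A))"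
      by (subst (1 2) emeasure_distr) (auto intro!: sets_PiM_I)
  qed (auto intro!: finite_measure.finite_measure_distr fin)
  show "emeasure \<mu> X = emeasure \<nu> X" if "X \<in> sets \<mu>" for X
  proof -
    from that obtain Y where Y: "Y \<in> sets ?PiM" "X = Y \<inter> mspace (path_space t)"
      by (auto simp: assms(2) sets_path_borel_PiM[OF t] sets_restrict_space)
    then have X: "X = (\<lambda>f. f) -` Y \<inter> space (path_borel t)" by (auto simp: space_path_borel)
    show ?thesis using Y(1) arg_cong[OF *, of "\<lambda>\<mu>. emeasure \<mu> Y"]
      by (simp add: emeasure_distr X)
  qed
qed (simp add: assms(2,3))

section \<open>Characteristic functions determine the laws of random vectors\<close>

lemma borel_measurable_iexp[measurable (raw)]:
  "f \<in> borel_measurable M \<Longrightarrow> (\<lambda>x. iexp (f x)) \<in> borel_measurable M"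
  by (rule measurable_compose[where g="\<lambda>r. iexp r"])
     (auto intro!: borel_measurable_continuous_onI continuous_intros)

lemma (in finite_measure) integrable_bounded:
  fixes f :: "'a \<Rightarrow> 'c::{banach, second_countable_topology}"
  assumes "f \<in> borel_measurable M" "\<And>x. x \<in> space M \<Longrightarrow> norm (f x) \<le> C"
  shows "integrable M f"
  using assms by (intro integrable_const_bound[of _ C]) auto

text \<open>
  A positive weight bounded away from \<open>0\<close> and from infinity turns, after normalisation, into a change of
  probability measure, so that Levy's uniqueness theorem on the line applies to the reweighted laws.
\<close>

lemma weighted_char_unique_real:
  fixes X :: "'a \<Rightarrow> real" and Y :: "'b \<Rightarrow> real" and v :: "'a \<Rightarrow> real" and w :: "'b \<Rightarrow> real"
  assumes "prob_space P" "prob_space Q"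
    and [measurable]: "X \<in> borel_measurable P" "Y \<in> borel_measurable Q"
      "v \<in> borel_measurable P" "w \<in> borel_measurable Q"
    and v: "\<And>x. x \<in> space P \<Longrightarrow> 1 \<le> v x \<and> v x \<le> C" and w: "\<And>y. y \<in> space Q \<Longrightarrow> 1 \<le> w y \<and> w y \<le> C"
    and eq: "\<And>u. (\<integral>x. v x * iexp (u * X x) \<partial>P) = (\<integral>y. w y * iexp (u * Y y) \<partial>Q)"
    and [measurable]: "A \<in> sets borel"
  shows "(\<integral>x. v x * indicator A (X x) \<partial>P) = (\<integral>y. w y * indicator A (Y y) \<partial>Q)"
proof -
  interpret P: prob_space P by fact
  interpret Q: prob_space Q by fact
  define m where "m = (\<integral>x. v x \<partial>P)"
  have iv: "integrable P v" and iw: "integrable Q w"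
    using v w by (force intro!: P.integrable_bounded[of _ C] Q.integrable_bounded[of _ C])+
  have "complex_of_real m = (\<integral>y. w y \<partial>Q)"
    using eq[of 0] by (simp add: m_def)
  then have m': "m = (\<integral>y. w y \<partial>Q)" by (simp only: of_real_eq_iff)
  have "1 \<le> m" unfolding m_def using v iv by (intro P.integral_ge_const) (auto intro: AE_I2)
  have dens: "real_distribution (distr (density R (\<lambda>x. ennreal (f x / m))) borel Z) \<and>
      (\<forall>u. char (distr (density R (\<lambda>x. ennreal (f x / m))) borel Z) u = (\<integral>x. f x * iexp (u * Z x) \<partial>R) / m) \<and>
      measure (distr (density R (\<lambda>x. ennreal (f x / m))) borel Z) A = (\<integral>x. f x * indicator A (Z x) \<partial>R) / m"
    if [measurable]: "f \<in> borel_measurable R" "Z \<in> borel_measurable R" and "integrable R f"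
      and pos: "\<And>x. x \<in> space R \<Longrightarrow> 1 \<le> f x" and mf: "(\<integral>x. f x \<partial>R) = m"
    for R :: "'c measure" and f :: "'c \<Rightarrow> real" and Z
  proof (intro conjI allI)
    let ?D = "density R (\<lambda>x. ennreal (f x / m))"
    have pos': "\<And>x. x \<in> space R \<Longrightarrow> 0 \<le> f x / m" using pos \<open>1 \<le> m\<close> by (smt (verit) divide_nonneg_nonneg)
    have "(\<integral>\<^sup>+x. ennreal (f x / m) \<partial>R) = ennreal (\<integral>x. f x / m \<partial>R)"
      using that pos' by (intro nn_integral_eq_integral) auto
    also have "\<dots> = 1" using mf \<open>1 \<le> m\<close> by simp
    finally have "prob_space ?D" by (intro prob_spaceI) (simp add: emeasure_density cong: nn_integral_cong)
    then interpret D: prob_space ?D .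
    show "real_distribution (distr ?D borel Z)"
      by (intro D.real_distribution_distr) simp
    show "char (distr ?D borel Z) u = (\<integral>x. f x * iexp (u * Z x) \<partial>R) / m" for u
    proof -
      have "char (distr ?D borel Z) u = (\<integral>x. iexp (u * Z x) \<partial>?D)"
        unfolding char_def by (subst integral_distr) auto
      also have "\<dots> = (\<integral>x. (f x / m) *\<^sub>R iexp (u * Z x) \<partial>R)"
        using pos' by (subst integral_density) (auto intro: AE_I2)
      also have "\<dots> = (\<integral>x. (f x * iexp (u * Z x)) / m \<partial>R)"
        by (simp add: scaleR_conv_of_real)
      finally show ?thesis by simp
    qed
    have "measure (distr ?D borel Z) A = (\<integral>x. indicator A (Z x) \<partial>?D)"
    proof -
      have "measure (distr ?D borel Z) A = (\<integral>z. indicator A z \<partial>distr ?D borel Z)" by simp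
      also have "\<dots> = (\<integral>x. indicator A (Z x) \<partial>?D)" by (intro integral_distr) auto
      finally show ?thesis .
    qed
    also have "\<dots> = (\<integral>x. (f x / m) * indicator A (Z x) \<partial>R)"
      using pos' by (subst integral_density) (auto intro: AE_I2)
    finally show "measure (distr ?D borel Z) A = (\<integral>x. f x * indicator A (Z x) \<partial>R) / m" by simp
  qed
  note dP = dens[of v P X, OF _ _ iv] and dQ = dens[of w Q Y, OF _ _ iw]
  have "distr (density P (\<lambda>x. ennreal (v x / m))) borel X = distr (density Q (\<lambda>x. ennreal (w x / m))) borel Y"
    using dP dQ v w eq by (intro Levy_uniqueness ext) (auto simp: m_def m'[symmetric])
  then have "(\<integral>x. v x * indicator A (X x) \<partial>P) / m = (\<integral>y. w y * indicator A (Y y) \<partial>Q) / m"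
    using dP dQ v w by (simp add: m_def m'[symmetric])
  then show ?thesis using \<open>1 \<le> m\<close> by simp
qed

text \<open>
  The same for complex weights. Conjugating the hypothesis and replacing \<open>u\<close> by \<open>-u\<close> shows that it passes to the
  conjugate weight, hence to the real and imaginary parts; a bounded real weight becomes positive
  after adding a constant, and the constant weight is covered by \<open>eq0\<close>.
\<close>

lemma weighted_char_unique:
  fixes X :: "'a \<Rightarrow> real" and Y :: "'b \<Rightarrow> real" and V :: "'a \<Rightarrow> complex" and W :: "'b \<Rightarrow> complex"
  assumes P: "prob_space P" and Q: "prob_space Q"
    and [measurable]: "X \<in> borel_measurable P" "Y \<in> borel_measurable Q"
      "V \<in> borel_measurable P" "W \<in> borel_measurable Q"
    and V: "\<And>x. norm (V x) \<le> 1" and W: "\<And>y. norm (W y) \<le> 1"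
    and eq0: "\<And>u. (\<integral>x. iexp (u * X x) \<partial>P) = (\<integral>y. iexp (u * Y y) \<partial>Q)"
    and eq: "\<And>u. (\<integral>x. V x * iexp (u * X x) \<partial>P) = (\<integral>y. W y * iexp (u * Y y) \<partial>Q)"
    and [measurable]: "A \<in> sets borel"
  shows "(\<integral>x. V x * indicator A (X x) \<partial>P) = (\<integral>y. W y * indicator A (Y y) \<partial>Q)"
proof -
  interpret P: prob_space P by fact
  interpret Q: prob_space Q by fact
  have [measurable]: "cnj \<in> borel_measurable borel"
    by (intro borel_measurable_continuous_onI continuous_intros)
  have intP: "integrable P (\<lambda>x. V x * iexp (u * X x))" "integrable P (\<lambda>x. cnj (V x) * iexp (u * X x))"
      "integrable P (\<lambda>x. iexp (u * X x))" for u
    using V by (auto intro!: P.integrable_bounded[of _ 1] simp: norm_mult)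
  have intQ: "integrable Q (\<lambda>x. W x * iexp (u * Y x))" "integrable Q (\<lambda>x. cnj (W x) * iexp (u * Y x))"
      "integrable Q (\<lambda>x. iexp (u * Y x))" for u
    using W by (auto intro!: Q.integrable_bounded[of _ 1] simp: norm_mult)
  have eq': "(\<integral>x. cnj (V x) * iexp (u * X x) \<partial>P) = (\<integral>y. cnj (W y) * iexp (u * Y y) \<partial>Q)" for u
  proof -
    have "(\<integral>x. cnj (V x) * iexp (u * X x) \<partial>P) = cnj (\<integral>x. V x * iexp (- u * X x) \<partial>P)"
      by (subst Bochner_Integration.integral_cnj[symmetric]) (simp add: exp_cnj)
    also have "\<dots> = cnj (\<integral>y. W y * iexp (- u * Y y) \<partial>Q)" by (simp only: eq)
    also have "\<dots> = (\<integral>y. cnj (W y) * iexp (u * Y y) \<partial>Q)"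
      by (subst Bochner_Integration.integral_cnj[symmetric]) (simp add: exp_cnj)
    finally show ?thesis .
  qed
  have shift: "(\<integral>x. f x * indicator A (X x) \<partial>P) = (\<integral>y. g y * indicator A (Y y) \<partial>Q)"
    if [measurable]: "f \<in> borel_measurable P" "g \<in> borel_measurable Q"
      and f: "\<And>x. \<bar>f x\<bar> \<le> 1" and g: "\<And>y. \<bar>g y\<bar> \<le> 1"
      and fg: "\<And>u. (\<integral>x. f x * iexp (u * X x) \<partial>P) = (\<integral>y. g y * iexp (u * Y y) \<partial>Q)"
    for f :: "'a \<Rightarrow> real" and g :: "'b \<Rightarrow> real"
  proof -
    have i: "integrable P (\<lambda>x. f x * indicator A (X x))" "integrable Q (\<lambda>x. g x * indicator A (Y x))"
      "integrable P (\<lambda>x. indicator A (X x) :: real)" "integrable Q (\<lambda>x. indicator A (Y x) :: real)"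
      "integrable P (\<lambda>x. f x * iexp (u * X x))" "integrable Q (\<lambda>x. g x * iexp (u * Y x))" for u
      using f g by (auto intro!: P.integrable_bounded[of _ 1] Q.integrable_bounded[of _ 1]
         simp: norm_mult indicator_def)
    have "(\<integral>x. (f x + 2) * indicator A (X x) \<partial>P) = (\<integral>y. (g y + 2) * indicator A (Y y) \<partial>Q)"
    proof (rule weighted_char_unique_real[OF P Q, where C=3])
      show "1 \<le> f x + 2 \<and> f x + 2 \<le> 3" "1 \<le> g y + 2 \<and> g y + 2 \<le> 3" for x y
        using f[of x] g[of y] by auto
      show "(\<integral>x. complex_of_real (f x + 2) * iexp (u * X x) \<partial>P)
          = (\<integral>y. complex_of_real (g y + 2) * iexp (u * Y y) \<partial>Q)" for u
        using fg[of u] eq0[of u] i intP intQ by (simp add: distrib_right)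
    qed measurable
    moreover have "(\<integral>x. 1 * indicator A (X x) \<partial>P) = (\<integral>y. 1 * indicator A (Y y) \<partial>Q :: real)"
      by (rule weighted_char_unique_real[OF P Q, where C=1]) (use eq0 in auto)
    ultimately show ?thesis using i by (simp add: distrib_right)
  qed
  have re: "(\<integral>x. Re (V x) * indicator A (X x) \<partial>P) = (\<integral>y. Re (W y) * indicator A (Y y) \<partial>Q)"
  proof (rule shift)
    have *: "complex_of_real (Re z) * c = (1/2) * (z * c + cnj z * c)" for z c :: complex
      by (simp add: complex_eq_iff)
    show "(\<integral>x. complex_of_real (Re (V x)) * iexp (u * X x) \<partial>P) = (\<integral>y. complex_of_real (Re (W y)) * iexp (u * Y y) \<partial>Q)" for u
      unfolding * using eq[of u] eq'[of u] intP[of u] intQ[of u] by simp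
    show "\<bar>Re (V x)\<bar> \<le> 1" "\<bar>Re (W y)\<bar> \<le> 1" for x y
      using V[of x] W[of y] abs_Re_le_cmod order_trans by blast+
  qed measurable
  have im: "(\<integral>x. Im (V x) * indicator A (X x) \<partial>P) = (\<integral>y. Im (W y) * indicator A (Y y) \<partial>Q)"
  proof (rule shift)
    have *: "complex_of_real (Im z) * c = (-\<i>/2) * (z * c - cnj z * c)" for z c :: complex
      by (simp add: complex_eq_iff)
    show "(\<integral>x. complex_of_real (Im (V x)) * iexp (u * X x) \<partial>P) = (\<integral>y. complex_of_real (Im (W y)) * iexp (u * Y y) \<partial>Q)" for u
      unfolding * using eq[of u] eq'[of u] intP[of u] intQ[of u] by simp
    show "\<bar>Im (V x)\<bar> \<le> 1" "\<bar>Im (W y)\<bar> \<le> 1" for x y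
      using V[of x] W[of y] abs_Im_le_cmod order_trans by blast+
  qed measurable
  have "integrable P (\<lambda>x. V x * indicator A (X x))" "integrable Q (\<lambda>y. W y * indicator A (Y y))"
    using V W by (auto intro!: P.integrable_bounded[of _ 1] Q.integrable_bounded[of _ 1]
         simp: norm_mult indicator_def)
  moreover have "Re (z * indicator A r) = Re z * indicator A r" "Im (z * indicator A r) = Im z * indicator A r"
    for z :: complex and r by (auto simp: indicator_def)
  ultimately show ?thesis using re im
    by (intro complex_eqI) (simp_all flip: integral_Re integral_Im)
qed

text \<open>
  Uniqueness of characteristic functions in several dimensions. The coordinates are converted
  one at a time: the exponential factors of the coordinates not yet treated, times the indicators of those already
  treated, form a bounded complex weight, so each step is a one-dimensional uniqueness statement.
\<close>

lemma char_unique_box: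
  fixes X :: "'i \<Rightarrow> 'a \<Rightarrow> real" and Y :: "'i \<Rightarrow> 'b \<Rightarrow> real"
  assumes P: "prob_space P" and Q: "prob_space Q" and I: "finite I"
    and [measurable]: "\<And>i. i \<in> I \<Longrightarrow> X i \<in> borel_measurable P" "\<And>i. i \<in> I \<Longrightarrow> Y i \<in> borel_measurable Q"
    and eq: "\<And>u. (\<integral>x. iexp (\<Sum>i\<in>I. u i * X i x) \<partial>P) = (\<integral>y. iexp (\<Sum>i\<in>I. u i * Y i y) \<partial>Q)"
    and [measurable]: "\<And>i. A i \<in> sets borel"
  shows "measure P {x \<in> space P. \<forall>i\<in>I. X i x \<in> A i} = measure Q {y \<in> space Q. \<forall>i\<in>I. Y i y \<in> A i}"
proof -
  interpret P: prob_space P by fact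
  interpret Q: prob_space Q by fact
  have "(\<integral>x. (\<Prod>i\<in>K. indicator (A i) (X i x)) * iexp (\<Sum>i\<in>I - K. u i * X i x) \<partial>P) =
     (\<integral>y. (\<Prod>i\<in>K. indicator (A i) (Y i y)) * iexp (\<Sum>i\<in>I - K. u i * Y i y) \<partial>Q)"
    if "K \<subseteq> I" for K u
    using finite_subset[OF that I] that
  proof (induction K arbitrary: u rule: finite_induct)
    case empty
    then show ?case using eq by simp
  next
    case (insert k K)
    then have k: "k \<in> I" "k \<notin> K" "K \<subseteq> I" by auto
    have [measurable]: "X k \<in> borel_measurable P" "Y k \<in> borel_measurable Q" using k by auto
    have [measurable]: "(\<lambda>x. \<Sum>i\<in>I - insert k K. u i * X i x) \<in> borel_measurable P"
       "(\<lambda>x. \<Sum>i\<in>I - insert k K. u i * Y i x) \<in> borel_measurable Q"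
       "(\<lambda>x. \<Prod>i\<in>K. indicator (A i) (X i x) :: complex) \<in> borel_measurable P"
       "(\<lambda>x. \<Prod>i\<in>K. indicator (A i) (Y i x) :: complex) \<in> borel_measurable Q"
    proof -
      have [measurable]: "X i \<in> borel_measurable P" "Y i \<in> borel_measurable Q" if "i \<in> K" for i
        using that k by auto
      show "(\<lambda>x. \<Sum>i\<in>I - insert k K. u i * X i x) \<in> borel_measurable P"
        "(\<lambda>x. \<Sum>i\<in>I - insert k K. u i * Y i x) \<in> borel_measurable Q"
        "(\<lambda>x. \<Prod>i\<in>K. indicator (A i) (X i x) :: complex) \<in> borel_measurable P"
        "(\<lambda>x. \<Prod>i\<in>K. indicator (A i) (Y i x) :: complex) \<in> borel_measurable Q"
        by measurable
    qed
    have ins: "(\<Prod>i\<in>insert k K. indicator (A i) (f i)) * iexp (\<Sum>i\<in>I - insert k K. u i * f i)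
       = (\<Prod>i\<in>K. indicator (A i) (f i)) * iexp (\<Sum>i\<in>I - insert k K. u i * f i) * indicator (A k) (f k)"
      for f :: "'i \<Rightarrow> real"
      using insert.hyps by simp
    have sum: "(\<Sum>i\<in>I - K. (u(k := r)) i * f i) = (\<Sum>i\<in>I - insert k K. u i * f i) + r * f k" for r and f :: "'i \<Rightarrow> real"
    proof -
      have "(\<Sum>i\<in>I - K. (u(k := r)) i * f i) = r * f k + (\<Sum>i\<in>I - K - {k}. (u(k := r)) i * f i)"
        using I k by (subst sum.remove[of _ k]) auto
      also have "I - K - {k} = I - insert k K" by auto
      also have "(\<Sum>i\<in>I - insert k K. (u(k := r)) i * f i) = (\<Sum>i\<in>I - insert k K. u i * f i)"
        by (intro sum.cong) auto
      finally show ?thesis by simp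
    qed
    have bound: "norm ((\<Prod>i\<in>K. indicator (A i) (f i)) * iexp r) \<le> 1" for f :: "'i \<Rightarrow> real" and r
      unfolding norm_mult norm_exp_i_times mult_1_right
      by (subst prod_norm[symmetric], intro prod_le_1) (auto simp: indicator_def)
    show ?case unfolding ins
    proof (rule weighted_char_unique[OF P Q])
      show "(\<integral>x. iexp (r * X k x) \<partial>P) = (\<integral>y. iexp (r * Y k y) \<partial>Q)" for r
      proof -
        have *: "(\<Sum>i\<in>I. (if i = k then r else 0) * f i) = r * f k" for f :: "'i \<Rightarrow> real"
          using I k by (simp add: if_distrib[of "\<lambda>c. c * _"] sum.delta cong: if_cong)
        show ?thesis using eq[of "\<lambda>i. if i = k then r else 0"] unfolding * .
      qed
      show "(\<integral>x. (\<Prod>i\<in>K. indicator (A i) (X i x)) * iexp (\<Sum>i\<in>I - insert k K. u i * X i x) * iexp (r * X k x) \<partial>P)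
        = (\<integral>y. (\<Prod>i\<in>K. indicator (A i) (Y i y)) * iexp (\<Sum>i\<in>I - insert k K. u i * Y i y) * iexp (r * Y k y) \<partial>Q)" for r
        using insert.IH[OF k(3), of "u(k := r)"] unfolding sum
        by (simp add: exp_add distrib_left mult.assoc)
    qed (simp_all only: bound, measurable)
  qed
  from this[of I "\<lambda>_. 0"] have "(\<integral>x. (\<Prod>i\<in>I. indicator (A i) (X i x)) \<partial>P) = (\<integral>y. (\<Prod>i\<in>I. indicator (A i) (Y i y)) \<partial>Q :: complex)"
    by simp
  moreover have meas: "(\<integral>x. (\<Prod>i\<in>I. indicator (A i) (Z i x)) \<partial>R) = complex_of_real (measure R {x \<in> space R. \<forall>i\<in>I. Z i x \<in> A i})"
    if "prob_space R" "\<And>i. i \<in> I \<Longrightarrow> Z i \<in> borel_measurable R" for R :: "'c measure" and Z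
  proof -
    interpret R: prob_space R by fact
    have "(\<integral>x. (\<Prod>i\<in>I. indicator (A i) (Z i x)) \<partial>R) = (\<integral>x. complex_of_real (indicator {x \<in> space R. \<forall>i\<in>I. Z i x \<in> A i} x) \<partial>R)"
      using I by (intro Bochner_Integration.integral_cong) (auto simp: indicator_def prod_zero_iff)
    also have "\<dots> = complex_of_real (measure R {x \<in> space R. \<forall>i\<in>I. Z i x \<in> A i})"
      by (simp add: integral_complex_of_real Int_absorb2 subset_iff)
    finally show ?thesis .
  qed
  ultimately show ?thesis
    using meas[OF P, of X] meas[OF Q, of Y] P Q by simp
qed

lemma char_unique:
  fixes X :: "'i \<Rightarrow> 'a \<Rightarrow> real" and Y :: "'i \<Rightarrow> 'b \<Rightarrow> real"
  assumes P: "prob_space P" and Q: "prob_space Q" and I: "finite I"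
    and X: "\<And>i. i \<in> I \<Longrightarrow> X i \<in> borel_measurable P" and Y: "\<And>i. i \<in> I \<Longrightarrow> Y i \<in> borel_measurable Q"
    and eq: "\<And>u. (\<integral>x. iexp (\<Sum>i\<in>I. u i * X i x) \<partial>P) = (\<integral>y. iexp (\<Sum>i\<in>I. u i * Y i y) \<partial>Q)"
  shows "distr P (PiM I (\<lambda>_. borel)) (\<lambda>x. \<lambda>i\<in>I. X i x) = distr Q (PiM I (\<lambda>_. borel)) (\<lambda>y. \<lambda>i\<in>I. Y i y)"
proof -
  interpret P: prob_space P by fact
  interpret Q: prob_space Q by fact
  have m: "(\<lambda>x. \<lambda>i\<in>I. X i x) \<in> P \<rightarrow>\<^sub>M PiM I (\<lambda>_. borel)" "(\<lambda>y. \<lambda>i\<in>I. Y i y) \<in> Q \<rightarrow>\<^sub>M PiM I (\<lambda>_. borel)"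
    using X Y by (auto intro!: measurable_restrict)
  show ?thesis
  proof (rule measure_eqI_PiM_finite[OF I])
    fix A assume A: "\<And>i. i \<in> I \<Longrightarrow> A i \<in> sets (borel :: real measure)"
    define A' where "A' i = (if i \<in> I then A i else UNIV)" for i
    have A': "A' i \<in> sets borel" for i using A by (auto simp: A'_def)
    have *: "(\<lambda>x. \<lambda>i\<in>I. Z i x) -` (Pi\<^sub>E I A) \<inter> space R = {x \<in> space R. \<forall>i\<in>I. Z i x \<in> A' i}"
      for R :: "'c measure" and Z by (auto simp: PiE_def Pi_iff A'_def)
    have "Pi\<^sub>E I A \<in> sets (PiM I (\<lambda>_. borel))" using I A by (auto intro: sets_PiM_I_finite)
    then show "emeasure (distr P (PiM I (\<lambda>_. borel)) (\<lambda>x. \<lambda>i\<in>I. X i x)) (Pi\<^sub>E I A) =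
      emeasure (distr Q (PiM I (\<lambda>_. borel)) (\<lambda>y. \<lambda>i\<in>I. Y i y)) (Pi\<^sub>E I A)"
      using m char_unique_box[OF P Q I X Y eq A']
      by (simp add: emeasure_distr * P.emeasure_eq_measure Q.emeasure_eq_measure)
  next
    show "range (\<lambda>_::nat. Pi\<^sub>E I (\<lambda>_. UNIV)) \<subseteq> prod_algebra I (\<lambda>_. borel :: real measure)"
      using I by (auto intro!: prod_algebraI_finite)
    show "emeasure (distr P (PiM I (\<lambda>_. borel)) (\<lambda>x. \<lambda>i\<in>I. X i x)) (Pi\<^sub>E I (\<lambda>_. UNIV)) \<noteq> \<infinity>"
      using finite_measure.emeasure_finite[OF P.finite_measure_distr[OF m(1)]] by simp
  qed (auto simp: space_PiM)
qed

lemma borel_measurable_vec_lambda: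
  fixes f :: "'a \<Rightarrow> 'n::finite \<Rightarrow> real"
  assumes "\<And>k. (\<lambda>x. f x k) \<in> borel_measurable M"
  shows "(\<lambda>x. \<chi> k. f x k) \<in> borel_measurable M"
  using assms by (subst borel_measurable_euclidean_space) (auto simp: Basis_vec_def inner_axis)

text \<open>
  Vector-valued version: a finite family of vectors in \<open>\<real>\<^sup>n\<close> is a finite family of reals indexed by pairs of a
  time and a coordinate.
\<close>

lemma vector_char_unique:
  fixes X :: "'i \<Rightarrow> 'a \<Rightarrow> real^'n::finite" and Y :: "'i \<Rightarrow> 'b \<Rightarrow> real^'n"
  assumes P: "prob_space P" and Q: "prob_space Q" and J: "finite J"
    and X: "\<And>s. s \<in> J \<Longrightarrow> X s \<in> borel_measurable P" and Y: "\<And>s. s \<in> J \<Longrightarrow> Y s \<in> borel_measurable Q"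
    and eq: "\<And>u. (\<integral>x. iexp (\<Sum>s\<in>J. u s \<bullet> X s x) \<partial>P) = (\<integral>y. iexp (\<Sum>s\<in>J. u s \<bullet> Y s y) \<partial>Q)"
    and A: "\<And>s. A s \<in> sets borel"
  shows "emeasure P {x \<in> space P. \<forall>s\<in>J. X s x \<in> A s} = emeasure Q {y \<in> space Q. \<forall>s\<in>J. Y s y \<in> A s}"
proof -
  let ?I = "J \<times> (UNIV :: 'n set)" and ?PiM = "PiM (J \<times> (UNIV :: 'n set)) (\<lambda>_. borel :: real measure)"
  have sum: "(\<Sum>i\<in>?I. u i * (case i of (s, k) \<Rightarrow> Z s $ k)) = (\<Sum>s\<in>J. (\<chi> k. u (s, k)) \<bullet> Z s)"
    for u and Z :: "'i \<Rightarrow> real^'n"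
    by (simp add: inner_vec_def sum.cartesian_product case_prod_unfold)
  have mc: "(\<lambda>x. case i of (s, k) \<Rightarrow> Z s x $ k) \<in> borel_measurable R"
    if "i \<in> ?I" "\<And>s. s \<in> J \<Longrightarrow> Z s \<in> borel_measurable R" for i and Z :: "'i \<Rightarrow> 'c \<Rightarrow> real^'n" and R :: "'c measure"
    using that(1) measurable_compose[OF that(2)[of "fst i"] borel_measurable_nth[of "snd i"]] by auto
  have eq': "distr P ?PiM (\<lambda>x. \<lambda>i\<in>?I. case i of (s, k) \<Rightarrow> X s x $ k) =
    distr Q ?PiM (\<lambda>y. \<lambda>i\<in>?I. case i of (s, k) \<Rightarrow> Y s y $ k)"
  proof (rule char_unique[OF P Q])
    show "(\<integral>x. iexp (\<Sum>i\<in>?I. u i * (case i of (s, k) \<Rightarrow> X s x $ k)) \<partial>P) =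
        (\<integral>y. iexp (\<Sum>i\<in>?I. u i * (case i of (s, k) \<Rightarrow> Y s y $ k)) \<partial>Q)" for u
      unfolding sum by (rule eq)
  qed (use J mc X Y in auto)
  define S where "S = {y \<in> space ?PiM. \<forall>s\<in>J. (\<chi> k. y (s, k)) \<in> A s}"
  have "{y \<in> space ?PiM. (\<chi> k. y (s, k)) \<in> A s} \<in> sets ?PiM" if "s \<in> J" for s
  proof -
    have "(\<lambda>y. \<chi> k. y (s, k)) \<in> borel_measurable ?PiM"
      using that by (intro borel_measurable_vec_lambda measurable_component_singleton) auto
    from measurable_sets[OF this A] show ?thesis by (simp add: vimage_def Int_def conj_commute)
  qed
  then have S: "S \<in> sets ?PiM" unfolding S_def using J by (intro sets.sets_Collect_finite_All) auto
  have ev: "emeasure (distr R ?PiM (\<lambda>x. \<lambda>i\<in>?I. case i of (s, k) \<Rightarrow> Z s x $ k)) S =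
      emeasure R {x \<in> space R. \<forall>s\<in>J. Z s x \<in> A s}"
    if "\<And>s. s \<in> J \<Longrightarrow> Z s \<in> borel_measurable R" for Z :: "'i \<Rightarrow> 'c \<Rightarrow> real^'n" and R :: "'c measure"
  proof -
    have "(\<lambda>x. \<lambda>i\<in>?I. case i of (s, k) \<Rightarrow> Z s x $ k) \<in> R \<rightarrow>\<^sub>M ?PiM"
      by (rule measurable_restrict, rule mc) (auto intro: that)
    moreover have "(\<lambda>x. \<lambda>i\<in>?I. case i of (s, k) \<Rightarrow> Z s x $ k) -` S \<inter> space R = {x \<in> space R. \<forall>s\<in>J. Z s x \<in> A s}"
      by (auto simp: S_def space_PiM)
    ultimately show ?thesis using S by (simp add: emeasure_distr)
  qed
  show ?thesis using arg_cong[OF eq', of "\<lambda>\<mu>. emeasure \<mu> S"] X Y by (simp add: ev)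
qed

section \<open>Characteristic functions of bridges and Brownian motions\<close>

lemma (in prob_space) iexp_normal:
  assumes D: "distributed M lborel Y (normal_density \<mu> \<sigma>)" and \<sigma>: "0 < \<sigma>"
  shows "(\<integral>x. iexp (u * Y x) \<partial>M) = iexp (u * \<mu>) * exp (- (u\<^sup>2 * \<sigma>\<^sup>2 / 2))"
proof -
  define Z where "Z x = (Y x - \<mu>) / \<sigma>" for x
  have Z: "distributed M lborel Z std_normal_density"
    using normal_standard_normal_convert[OF \<sigma>, of Y \<mu>] D unfolding Z_def[abs_def] by simp
  then have mZ: "Z \<in> M \<rightarrow>\<^sub>M lborel" and dZ: "distr M lborel Z = std_normal_distribution"
    by (auto simp: distributed_def)
  have "(\<integral>x. iexp (u * Y x) \<partial>M) = (\<integral>x. iexp (u * \<mu>) * iexp ((u * \<sigma>) * Z x) \<partial>M)"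
    using \<sigma> by (intro Bochner_Integration.integral_cong) (simp_all add: Z_def exp_add[symmetric] field_simps)
  also have "\<dots> = iexp (u * \<mu>) * (\<integral>x. iexp ((u * \<sigma>) * Z x) \<partial>M)" by simp
  also have "(\<integral>x. iexp ((u * \<sigma>) * Z x) \<partial>M) = (\<integral>z. iexp ((u * \<sigma>) * z) \<partial>distr M lborel Z)"
    using mZ by (subst integral_distr) auto
  also have "\<dots> = char std_normal_distribution (u * \<sigma>)" unfolding dZ char_def ..
  finally show ?thesis by (simp add: char_std_normal_distribution power_mult_distrib)
qed

lemma (in prob_space) gaussian_variable_cases:
  assumes "gaussian_variable M Y"
  obtains (const) \<mu> where "AE x in M. Y x = \<mu>"
    | (normal) \<mu> \<sigma> where "0 < \<sigma>" "distributed M lborel Y (normal_density \<mu> \<sigma>)"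
proof -
  from assms obtain \<mu> \<sigma> where [measurable]: "Y \<in> borel_measurable M" and \<sigma>: "0 \<le> \<sigma>"
    and d: "distr M borel Y = (if \<sigma> = 0 then return borel \<mu> else density lborel (normal_density \<mu> \<sigma>))"
    unfolding gaussian_variable_def by auto
  show thesis
  proof (cases "\<sigma> = 0")
    case True
    have "AE y in distr M borel Y. y = \<mu>" using AE_return[of \<mu> borel "\<lambda>y. y = \<mu>"] by (subst d) (simp add: True)
    then have "AE x in M. Y x = \<mu>" by (rule AE_distrD[rotated]) simp
    then show thesis by (rule const)
  next
    case False
    have "distr M lborel Y = distr M borel Y" by (intro distr_cong) auto
    then have "distributed M lborel Y (normal_density \<mu> \<sigma>)"
      using d False by (auto simp: distributed_def)
    with False \<sigma> show thesis by (intro normal) auto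
  qed
qed

text \<open>
  Degenerate and nondegenerate Gaussian variables share one formula for the characteristic function
  in terms of mean and variance, so sums of the two kinds can be treated alike.
\<close>

lemma (in prob_space) gaussian_variable_facts:
  assumes Y: "gaussian_variable M Y"
  shows gaussian_variable_integrable: "integrable M Y"
    and gaussian_variable_integrable_square: "integrable M (\<lambda>x. (Y x)\<^sup>2)"
    and gaussian_variable_iexp:
      "(\<integral>x. iexp (Y x) \<partial>M) = iexp (expectation Y) * exp (- covariance M Y Y / 2)"
proof -
  have [measurable]: "Y \<in> borel_measurable M" using Y by (simp add: gaussian_variable_def)
  have "integrable M Y \<and> integrable M (\<lambda>x. (Y x)\<^sup>2) \<and>
    (\<integral>x. iexp (Y x) \<partial>M) = iexp (expectation Y) * exp (- covariance M Y Y / 2)"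
    using Y
  proof (cases rule: gaussian_variable_cases)
    case (const \<mu>)
    have "integrable M Y \<longleftrightarrow> integrable M (\<lambda>_. \<mu>)" "integrable M (\<lambda>x. (Y x)\<^sup>2) \<longleftrightarrow> integrable M (\<lambda>_. \<mu>\<^sup>2)"
      using const by (intro integrable_cong_AE; force)+
    moreover have E: "expectation Y = expectation (\<lambda>_. \<mu>)"
       "(\<integral>x. iexp (Y x) \<partial>M) = (\<integral>x. iexp \<mu> \<partial>M)"
      using const by (intro integral_cong_AE; force)+
    moreover have "covariance M Y Y = (\<integral>x. 0 \<partial>M)"
      unfolding covariance_def using const by (intro integral_cong_AE) (auto simp: E(1) prob_space)
    ultimately show ?thesis by (simp add: prob_space)
  next
    case (normal \<mu> \<sigma>)
    note D = normal(2)
    have i1: "integrable M Y"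
      using distributed_integrable[OF D, of "\<lambda>x. x"] integrable_normal_moment_nz_1[OF normal(1), of \<mu>] by simp
    have "integrable M (\<lambda>x. (Y x - \<mu>)\<^sup>2)"
      using distributed_integrable[OF D, of "\<lambda>x. (x - \<mu>)\<^sup>2"] integrable_normal_moment[OF normal(1), of \<mu> 2] by simp
    then have "integrable M (\<lambda>x. (Y x - \<mu>)\<^sup>2 + 2 * \<mu> * Y x - \<mu>\<^sup>2)" using i1 by auto
    then have i2: "integrable M (\<lambda>x. (Y x)\<^sup>2)" by (simp add: power2_eq_square algebra_simps)
    have "expectation Y = \<mu>" using normal_distributed_expectation[OF normal] .
    moreover have "covariance M Y Y = \<sigma>\<^sup>2"
      using normal_distributed_variance[OF normal] by (simp add: covariance_def power2_eq_square)
    ultimately show ?thesis using i1 i2 iexp_normal[OF D normal(1), of 1] by simp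
  qed
  then show "integrable M Y" "integrable M (\<lambda>x. (Y x)\<^sup>2)"
    "(\<integral>x. iexp (Y x) \<partial>M) = iexp (expectation Y) * exp (- covariance M Y Y / 2)" by auto
qed

lemma (in prob_space) integrable_mult_square:
  fixes Y Z :: "'a \<Rightarrow> real"
  assumes [measurable]: "Y \<in> borel_measurable M" "Z \<in> borel_measurable M"
    and "integrable M (\<lambda>x. (Y x)\<^sup>2)" "integrable M (\<lambda>x. (Z x)\<^sup>2)"
  shows "integrable M (\<lambda>x. Y x * Z x)"
proof (rule Bochner_Integration.integrable_bound)
  show "integrable M (\<lambda>x. (Y x)\<^sup>2 + (Z x)\<^sup>2)" using assms by simp
  have "\<bar>y * z\<bar> \<le> y\<^sup>2 + z\<^sup>2" for y z :: real
  proof -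
    have "2 * (\<bar>y\<bar> * \<bar>z\<bar>) \<le> y\<^sup>2 + z\<^sup>2"
      using sum_squares_bound[of "\<bar>y\<bar>" "\<bar>z\<bar>"] by (simp add: mult.assoc)
    moreover have "0 \<le> \<bar>y\<bar> * \<bar>z\<bar>" by simp
    ultimately show ?thesis unfolding abs_mult by linarith
  qed
  then show "AE x in M. norm (Y x * Z x) \<le> norm ((Y x)\<^sup>2 + (Z x)\<^sup>2)" by simp
qed simp

text \<open>
  The covariance function \<open>s (t - r) / t\<close> of the Brownian bridge for \<open>s \<le> r\<close>, written symmetrically. In this form
  it is visibly the Brownian covariance \<open>min s r\<close> minus that of the straight line \<open>(s / t) Z\<close> with \<open>Z\<close> of
  variance \<open>t\<close>.
\<close>

definition bridge_cov :: "real \<Rightarrow> real \<Rightarrow> real \<Rightarrow> real" where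
  "bridge_cov t s r = min s r - s * r / t"

lemma brownian_bridge_iexp:
  assumes bb: "brownian_bridge P t x \<beta>" and J: "finite J" "J \<subseteq> {0..t}" and t: "0 < t"
  shows "(\<integral>\<omega>. iexp (\<Sum>s\<in>J. c s * \<beta> s \<omega>) \<partial>P) =
     iexp (\<Sum>s\<in>J. c s * (s / t * x)) * exp (- (\<Sum>s\<in>J. \<Sum>r\<in>J. c s * c r * bridge_cov t s r) / 2)"
proof -
  have P: "prob_space P" and m: "\<And>s. s \<in> {0..t} \<Longrightarrow> \<beta> s \<in> borel_measurable P"
    and g: "gaussian_process P t \<beta>" and mean: "\<And>s. s \<in> {0..t} \<Longrightarrow> integral\<^sup>L P (\<beta> s) = x / t * s"
    and cov: "\<And>s r. 0 \<le> s \<Longrightarrow> s \<le> r \<Longrightarrow> r \<le> t \<Longrightarrow> covariance P (\<beta> s) (\<beta> r) = s * (t - r) / t"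
    using bb by (auto simp: brownian_bridge_def continuous_process_def)
  interpret prob_space P by fact
  have cov': "covariance P (\<beta> s) (\<beta> r) = bridge_cov t s r" if "s \<in> {0..t}" "r \<in> {0..t}" for s r
  proof (cases "s \<le> r")
    case True
    then show ?thesis using cov[of s r] that t by (simp add: bridge_cov_def field_simps)
  next
    case False
    have "covariance P (\<beta> s) (\<beta> r) = covariance P (\<beta> r) (\<beta> s)"
      by (simp add: covariance_def mult.commute)
    then show ?thesis using False cov[of r s] that t by (simp add: bridge_cov_def field_simps)
  qed
  have g1: "gaussian_variable P (\<beta> s)" if "s \<in> {0..t}" for s
  proof -
    have "gaussian_variable P (\<lambda>\<omega>. \<Sum>r\<in>{s}. 1 * \<beta> r \<omega>)"
      using g that unfolding gaussian_process_def by (elim allE[of _ "{s}"] allE[of _ "\<lambda>_. 1"]) auto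
    then show ?thesis by simp
  qed
  define m' where "m' s = x / t * s" for s
  have i1: "integrable P (\<beta> s)" and i2: "integrable P (\<lambda>\<omega>. (\<beta> s \<omega> - m' s)\<^sup>2)" if "s \<in> {0..t}" for s
    using gaussian_variable_facts[OF g1[OF that]] by (auto simp: power2_diff)
  have i3: "integrable P (\<lambda>\<omega>. (\<beta> s \<omega> - m' s) * (\<beta> r \<omega> - m' r))" if "s \<in> {0..t}" "r \<in> {0..t}" for s r
    using that m i2 by (intro integrable_mult_square) auto
  define Y where "Y \<omega> = (\<Sum>s\<in>J. c s * \<beta> s \<omega>)" for \<omega>
  have gY: "gaussian_variable P Y" using g J by (auto simp: gaussian_process_def Y_def[abs_def])
  have EY: "expectation Y = (\<Sum>s\<in>J. c s * m' s)"
    unfolding Y_def using J i1 mean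
    by (subst Bochner_Integration.integral_sum) (auto simp: subset_iff m'_def intro!: sum.cong)
  have "covariance P Y Y = (\<integral>\<omega>. (\<Sum>s\<in>J. \<Sum>r\<in>J. c s * c r * ((\<beta> s \<omega> - m' s) * (\<beta> r \<omega> - m' r))) \<partial>P)"
    unfolding covariance_def EY
  proof (intro Bochner_Integration.integral_cong refl)
    fix \<omega>
    have "Y \<omega> - (\<Sum>s\<in>J. c s * m' s) = (\<Sum>s\<in>J. c s * (\<beta> s \<omega> - m' s))"
      by (simp add: Y_def sum_subtractf[symmetric] right_diff_distrib)
    then show "(Y \<omega> - (\<Sum>s\<in>J. c s * m' s)) * (Y \<omega> - (\<Sum>s\<in>J. c s * m' s)) =
       (\<Sum>s\<in>J. \<Sum>r\<in>J. c s * c r * ((\<beta> s \<omega> - m' s) * (\<beta> r \<omega> - m' r)))"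
      by (simp add: sum_product algebra_simps)
  qed
  also have "\<dots> = (\<Sum>s\<in>J. \<Sum>r\<in>J. c s * c r * (\<integral>\<omega>. (\<beta> s \<omega> - m' s) * (\<beta> r \<omega> - m' r) \<partial>P))"
  proof -
    have i4: "integrable P (\<lambda>\<omega>. c s * c r * ((\<beta> s \<omega> - m' s) * (\<beta> r \<omega> - m' r)))" if "s \<in> J" "r \<in> J" for s r
    proof -
      have "s \<in> {0..t}" "r \<in> {0..t}" using that J by auto
      from i3[OF this] show ?thesis by simp
    qed
    show ?thesis
      using i4 by (simp add: Bochner_Integration.integral_sum)
  qed
  also have "\<dots> = (\<Sum>s\<in>J. \<Sum>r\<in>J. c s * c r * bridge_cov t s r)"
    using cov' J mean by (intro sum.cong refl) (auto simp: covariance_def m'_def subset_iff)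
  finally have "covariance P Y Y = (\<Sum>s\<in>J. \<Sum>r\<in>J. c s * c r * bridge_cov t s r)" .
  moreover have "(\<Sum>s\<in>J. c s * m' s) = (\<Sum>s\<in>J. c s * (s / t * x))" by (simp add: m'_def ac_simps)
  ultimately show ?thesis
    using gaussian_variable_iexp[OF gY] EY unfolding Y_def by simp
qed

lemma sum_telescope_if:
  fixes a :: "nat \<Rightarrow> 'a::ab_group_add"
  assumes "i < n"
  shows "(\<Sum>k<n. if k \<le> i then a (Suc k) - a k else 0) = a (Suc i) - a 0"
proof -
  have "(\<Sum>k<n. if k \<le> i then a (Suc k) - a k else 0) = (\<Sum>k<Suc i. a (Suc k) - a k)"
    using assms by (intro sum.mono_neutral_cong_right) auto
  then show ?thesis using sum_lessThan_telescope[of a "Suc i"] by simp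
qed

text \<open>
  Sorting \<open>J\<close> and putting \<open>0\<close> in front gives times \<open>\<tau> 0 \<le> \<tau> 1 \<le> \<dots>\<close>; a linear combination of the \<open>B s\<close> is then a
  linear combination of independent increments, and \<open>min s r\<close> is the total length of the
  intervals preceding both \<open>s\<close> and \<open>r\<close>.
\<close>

lemma brownian_motion_iexp:
  assumes bm: "brownian_motion P t B" and J: "finite J" "J \<subseteq> {0..t}" and t: "0 < t"
  shows "(\<integral>\<omega>. iexp (\<Sum>s\<in>J. c s * B s \<omega>) \<partial>P) = exp (- (\<Sum>s\<in>J. \<Sum>r\<in>J. c s * c r * min s r) / 2)"
proof -
  have P: "prob_space P" and m: "\<And>s. s \<in> {0..t} \<Longrightarrow> B s \<in> borel_measurable P"
    and B0: "AE \<omega> in P. B 0 \<omega> = 0"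
    and incr: "\<And>r s. 0 \<le> r \<Longrightarrow> r < s \<Longrightarrow> s \<le> t \<Longrightarrow>
        distributed P lborel (\<lambda>\<omega>. B s \<omega> - B r \<omega>) (normal_density 0 (sqrt (s - r)))"
    and ind: "\<And>n \<tau>. \<tau> ` {..n} \<subseteq> {0..t} \<Longrightarrow> mono_on {..n} \<tau> \<Longrightarrow>
        prob_space.indep_vars P (\<lambda>_. borel) (\<lambda>i \<omega>. B (\<tau> (Suc i)) \<omega> - B (\<tau> i) \<omega>) {..<n::nat}"
    using bm by (auto simp: brownian_motion_def continuous_process_def)
  interpret prob_space P by fact
  define xs where "xs = sorted_list_of_set J"
  have xs: "set xs = J" "sorted xs" "distinct xs" using J by (auto simp: xs_def)
  define n where "n = length xs"
  define \<tau> where "\<tau> i = (case i of 0 \<Rightarrow> 0 | Suc k \<Rightarrow> xs ! k)" for i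
  have \<tau>_simps[simp]: "\<tau> 0 = 0" "\<tau> (Suc k) = xs ! k" for k by (auto simp: \<tau>_def)
  have xs_in: "xs ! k \<in> J" if "k < n" for k using that xs n_def nth_mem by blast
  have \<tau>_in: "\<tau> i \<in> {0..t}" if "i \<le> n" for i
    using that xs_in[of "i - 1"] J t by (cases i) auto
  have \<tau>_mono: "\<tau> i \<le> \<tau> j" if "i \<le> j" "j \<le> n" for i j
    using that \<tau>_in[of j] sorted_nth_mono[OF xs(2), of "i - 1" "j - 1"] by (cases i; cases j) (auto simp: n_def)
  define D where "D k \<omega> = B (\<tau> (Suc k)) \<omega> - B (\<tau> k) \<omega>" for k \<omega>
  define \<Delta> where "\<Delta> k = \<tau> (Suc k) - \<tau> k" for k
  \<comment> \<open>The increment \<open>D k\<close> enters \<open>B (xs ! i)\<close> exactly when \<open>k \<le> i\<close>; \<open>e k\<close> is its total coefficient.\<close>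
  define e where "e k = (\<Sum>i<n. if k \<le> i then c (xs ! i) else 0)" for k
  have bij: "bij_betw ((!) xs) {..<n} J" unfolding n_def using xs by (metis bij_betw_nth)
  have ind': "indep_vars (\<lambda>_. borel) D {..<n}"
  proof -
    have "\<tau> ` {..n} \<subseteq> {0..t}" using \<tau>_in by auto
    moreover have "mono_on {..n} \<tau>" using \<tau>_mono by (intro mono_onI) auto
    ultimately show ?thesis unfolding D_def[abs_def] by (rule ind)
  qed
  have sumB: "AE \<omega> in P. (\<Sum>s\<in>J. c s * B s \<omega>) = (\<Sum>k<n. e k * D k \<omega>)"
    using B0
  proof eventually_elim
    case (elim \<omega>)
    have "(\<Sum>s\<in>J. c s * B s \<omega>) = (\<Sum>i<n. c (xs ! i) * B (xs ! i) \<omega>)"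
      using sum.reindex_bij_betw[OF bij, of "\<lambda>s. c s * B s \<omega>"] by simp
    also have "\<dots> = (\<Sum>i<n. c (xs ! i) * (\<Sum>k<n. if k \<le> i then D k \<omega> else 0))"
      using sum_telescope_if[of _ n "\<lambda>k. B (\<tau> k) \<omega>"] elim
      by (intro sum.cong refl) (simp add: D_def cong: if_cong)
    also have "\<dots> = (\<Sum>i<n. \<Sum>k<n. (if k \<le> i then c (xs ! i) else 0) * D k \<omega>)"
      unfolding sum_distrib_left by (intro sum.cong refl) auto
    also have "\<dots> = (\<Sum>k<n. e k * D k \<omega>)"
      unfolding e_def sum_distrib_right by (rule sum.swap)
    finally show ?case .
  qed
  have eD: "(\<integral>\<omega>. iexp (e k * D k \<omega>) \<partial>P) = exp (- ((e k)\<^sup>2 * \<Delta> k) / 2)" if k: "k < n" for k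
  proof (cases "\<Delta> k = 0")
    case True
    then have "D k \<omega> = 0" for \<omega> by (simp add: D_def \<Delta>_def)
    then show ?thesis using True by (simp add: prob_space)
  next
    case False
    with \<tau>_mono[of k "Suc k"] k have lt: "\<tau> k < \<tau> (Suc k)" by (auto simp: \<Delta>_def)
    have "distributed P lborel (D k) (normal_density 0 (sqrt (\<Delta> k)))"
      unfolding D_def[abs_def] \<Delta>_def using lt \<tau>_in[of k] \<tau>_in[of "Suc k"] k by (intro incr) auto
    from iexp_normal[OF this, of "e k"] lt show ?thesis by (simp add: \<Delta>_def)
  qed
  have mD[measurable]: "D k \<in> borel_measurable P" if "k < n" for k
    using m \<tau>_in[of k] \<tau>_in[of "Suc k"] that by (auto simp: D_def[abs_def])
  have m_iexp[measurable]: "(\<lambda>y. iexp (e k * y)) \<in> borel_measurable borel" for k by measurable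
  have ind_exp: "indep_vars (\<lambda>_. borel) (\<lambda>k \<omega>. iexp (e k * D k \<omega>)) {..<n}"
    using indep_vars_compose2[OF ind', of "\<lambda>k y. iexp (e k * y)" "\<lambda>_. borel"] by simp
  have mJ: "\<And>s. s \<in> J \<Longrightarrow> B s \<in> borel_measurable P" using m J by auto
  have "(\<integral>\<omega>. iexp (\<Sum>s\<in>J. c s * B s \<omega>) \<partial>P) = (\<integral>\<omega>. iexp (\<Sum>k<n. e k * D k \<omega>) \<partial>P)"
  proof (rule integral_cong_AE)
    show "AE \<omega> in P. iexp (\<Sum>s\<in>J. c s * B s \<omega>) = iexp (\<Sum>k<n. e k * D k \<omega>)"
      using sumB by eventually_elim simp
    show "(\<lambda>\<omega>. iexp (\<Sum>s\<in>J. c s * B s \<omega>)) \<in> borel_measurable P"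
      using mJ by (intro borel_measurable_iexp borel_measurable_sum borel_measurable_times) auto
    show "(\<lambda>\<omega>. iexp (\<Sum>k<n. e k * D k \<omega>)) \<in> borel_measurable P"
      using mD by (intro borel_measurable_iexp borel_measurable_sum borel_measurable_times) auto
  qed
  also have "\<dots> = (\<integral>\<omega>. (\<Prod>k<n. iexp (e k * D k \<omega>)) \<partial>P)"
    by (simp only: of_real_sum sum_distrib_left exp_sum[OF finite_lessThan])
  also have "\<dots> = (\<Prod>k<n. \<integral>\<omega>. iexp (e k * D k \<omega>) \<partial>P)"
  proof (rule indep_vars_lebesgue_integral[OF _ ind_exp])
    show "integrable P (\<lambda>\<omega>. iexp (e k * D k \<omega>))" if "k \<in> {..<n}" for k
      using that by (intro integrable_bounded[of _ 1]) auto
  qed simp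
  also have "\<dots> = (\<Prod>k<n. complex_of_real (exp (- ((e k)\<^sup>2 * \<Delta> k) / 2)))" using eD by simp
  also have "\<dots> = complex_of_real (exp (\<Sum>k<n. - ((e k)\<^sup>2 * \<Delta> k) / 2))" by (simp add: exp_sum)
  also have "(\<Sum>k<n. - ((e k)\<^sup>2 * \<Delta> k) / 2) = - (\<Sum>k<n. (e k)\<^sup>2 * \<Delta> k) / 2"
    by (simp add: sum_divide_distrib sum_negf)
  also have "(\<Sum>k<n. (e k)\<^sup>2 * \<Delta> k) = (\<Sum>s\<in>J. \<Sum>r\<in>J. c s * c r * min s r)"
  proof -
    have min_eq: "min (xs ! i) (xs ! j) = (\<Sum>k<n. if k \<le> i \<and> k \<le> j then \<Delta> k else 0)" if "i < n" "j < n" for i j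
    proof -
      have "(\<Sum>k<n. if k \<le> i \<and> k \<le> j then \<Delta> k else 0) = (\<Sum>k<n. if k \<le> min i j then \<tau> (Suc k) - \<tau> k else 0)"
        by (intro sum.cong) (auto simp: \<Delta>_def)
      also have "\<dots> = \<tau> (Suc (min i j))" using that by (subst sum_telescope_if) auto
      also have "\<dots> = min (xs ! i) (xs ! j)"
        using sorted_nth_mono[OF xs(2), of i j] sorted_nth_mono[OF xs(2), of j i] that by (auto simp: min_def n_def)
      finally show ?thesis by simp
    qed
    have "(\<Sum>s\<in>J. \<Sum>r\<in>J. c s * c r * min s r) = (\<Sum>i<n. \<Sum>j<n. c (xs ! i) * c (xs ! j) * min (xs ! i) (xs ! j))"
      by (simp add: sum.reindex_bij_betw[OF bij, symmetric])
    also have "\<dots> = (\<Sum>i<n. \<Sum>j<n. \<Sum>k<n. (if k \<le> i then c (xs ! i) else 0) * (if k \<le> j then c (xs ! j) else 0) * \<Delta> k)"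
      by (intro sum.cong refl) (auto simp: min_eq sum_distrib_left intro!: sum.cong)
    also have "\<dots> = (\<Sum>k<n. \<Sum>i<n. \<Sum>j<n. (if k \<le> i then c (xs ! i) else 0) * (if k \<le> j then c (xs ! j) else 0) * \<Delta> k)"
      by (subst (2) sum.swap) (subst (3) sum.swap, simp)
    also have "\<dots> = (\<Sum>k<n. (e k)\<^sup>2 * \<Delta> k)"
      by (simp only: e_def power2_eq_square sum_product) (simp only: sum_distrib_right)
    finally show ?thesis ..
  qed
  finally show ?thesis .
qed

text \<open>
  Exponentials of linear functionals of the three paths are measurable functions of the sample paths, and hence
  inherit their independence: first \<open>\<beta>\<close> is split off from the pair, then the pair is split.
\<close>

lemma bridge_planar_motion_iexp:
  assumes bm: "brownian_motion_2d P t B\<^sub>2 B\<^sub>3" and ind: "indep_of_pair P t \<beta> B\<^sub>2 B\<^sub>3"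
    and c\<beta>: "continuous_process P t \<beta>" and J: "finite J" "J \<subseteq> {0..t}"
  shows "(\<integral>\<omega>. iexp ((\<Sum>s\<in>J. a s * \<beta> s \<omega>) + (\<Sum>s\<in>J. b s * B\<^sub>2 s \<omega>) + (\<Sum>s\<in>J. c s * B\<^sub>3 s \<omega>)) \<partial>P) =
    (\<integral>\<omega>. iexp (\<Sum>s\<in>J. a s * \<beta> s \<omega>) \<partial>P) *
    ((\<integral>\<omega>. iexp (\<Sum>s\<in>J. b s * B\<^sub>2 s \<omega>) \<partial>P) * (\<integral>\<omega>. iexp (\<Sum>s\<in>J. c s * B\<^sub>3 s \<omega>) \<partial>P))"
proof -
  have c2: "continuous_process P t B\<^sub>2" and c3: "continuous_process P t B\<^sub>3"
    using bm by (auto simp: brownian_motion_2d_def brownian_motion_def)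
  interpret prob_space P using c2 by (simp add: continuous_process_def)
  let ?S = "PiM {0..t} (\<lambda>_. borel) :: (real \<Rightarrow> real) measure"
  define h where "h a f = iexp (\<Sum>s\<in>J. a s * f s)" for a f :: "real \<Rightarrow> real"
  have h[measurable]: "h a \<in> borel_measurable ?S" for a
    unfolding h_def using J
    by (intro borel_measurable_iexp borel_measurable_sum borel_measurable_times measurable_component_singleton) auto
  have sp: "sample_path t X \<in> P \<rightarrow>\<^sub>M ?S" if "continuous_process P t X" for X
    unfolding sample_path_def using that by (intro measurable_restrict) (auto simp: continuous_process_def)
  note [measurable] = sp[OF c\<beta>] sp[OF c2] sp[OF c3]
  have h_sp: "h a (sample_path t X \<omega>) = iexp (\<Sum>s\<in>J. a s * X s \<omega>)" for a X \<omega>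
    unfolding h_def sample_path_def using J by (intro arg_cong[where f=iexp] sum.cong) auto
  have norm_h: "norm (h a f) = 1" for a f by (simp add: h_def)
  have int: "integrable P (\<lambda>\<omega>. h a (sample_path t X \<omega>))" if "continuous_process P t X" for a X
    using sp[OF that] by (intro integrable_bounded[of _ 1]) (simp_all add: norm_h)
  have ind23: "indep_var borel (h b \<circ> sample_path t B\<^sub>2) borel (h c \<circ> sample_path t B\<^sub>3)"
  proof (rule indep_var_compose[OF _ h h])
    show "indep_var ?S (sample_path t B\<^sub>2) ?S (sample_path t B\<^sub>3)"
      using bm by (simp add: brownian_motion_2d_def)
  qed
  have sub: "sigma_sets (space P) {f -` A \<inter> space P |A. A \<in> sets borel} \<subseteq> sets V"
    if "f \<in> borel_measurable V" "space V = space P" for V and f :: "'a \<Rightarrow> complex"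
    unfolding that(2)[symmetric]
    by (rule sets.sigma_sets_subset) (auto intro: measurable_sets[OF that(1)])
  have ind1: "indep_var borel (\<lambda>\<omega>. h a (sample_path t \<beta> \<omega>)) borel (\<lambda>\<omega>. h b (sample_path t B\<^sub>2 \<omega>) * h c (sample_path t B\<^sub>3 \<omega>))"
    unfolding indep_var_eq indep_set_def
  proof (intro conjI)
    let ?V = "vimage_algebra (space P) (sample_path t \<beta>) ?S"
    let ?p = "\<lambda>\<omega>. (sample_path t B\<^sub>2 \<omega>, sample_path t B\<^sub>3 \<omega>)"
    let ?W = "vimage_algebra (space P) ?p (?S \<Otimes>\<^sub>M ?S)"
    have "sample_path t \<beta> \<in> ?V \<rightarrow>\<^sub>M ?S"
      using measurable_space[OF sp[OF c\<beta>]] by (intro measurable_vimage_algebra1) auto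
    then have "(\<lambda>\<omega>. h a (sample_path t \<beta> \<omega>)) \<in> borel_measurable ?V" by measurable
    then have 1: "sigma_sets (space P) {(\<lambda>\<omega>. h a (sample_path t \<beta> \<omega>)) -` A \<inter> space P |A. A \<in> sets borel} \<subseteq> sets ?V"
      by (rule sub) simp
    have "?p \<in> ?W \<rightarrow>\<^sub>M ?S \<Otimes>\<^sub>M ?S"
      using measurable_space[OF sp[OF c2]] measurable_space[OF sp[OF c3]]
      by (intro measurable_vimage_algebra1) (auto simp: space_pair_measure)
    moreover have "(\<lambda>(f, g). h b f * h c g) \<in> borel_measurable (?S \<Otimes>\<^sub>M ?S)" by measurable
    ultimately have "(\<lambda>\<omega>. (\<lambda>(f, g). h b f * h c g) (?p \<omega>)) \<in> borel_measurable ?W"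
      by (rule measurable_compose)
    then have 2: "sigma_sets (space P) {(\<lambda>\<omega>. h b (sample_path t B\<^sub>2 \<omega>) * h c (sample_path t B\<^sub>3 \<omega>)) -` A \<inter> space P |A. A \<in> sets borel} \<subseteq> sets ?W"
      by (intro sub) simp_all
    have "indep_sets (case_bool (sets ?V) (sets ?W)) UNIV"
      using ind unfolding indep_of_pair_def indep_set_def .
    then show "indep_sets (case_bool
       (sigma_sets (space P) {(\<lambda>\<omega>. h a (sample_path t \<beta> \<omega>)) -` A \<inter> space P |A. A \<in> sets borel})
       (sigma_sets (space P) {(\<lambda>\<omega>. h b (sample_path t B\<^sub>2 \<omega>) * h c (sample_path t B\<^sub>3 \<omega>)) -` A \<inter> space P |A. A \<in> sets borel})) UNIV"
      by (rule indep_sets_mono_sets) (use 1 2 in \<open>simp split: bool.split\<close>)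
  qed measurable
  have "(\<integral>\<omega>. h a (sample_path t \<beta> \<omega>) * (h b (sample_path t B\<^sub>2 \<omega>) * h c (sample_path t B\<^sub>3 \<omega>)) \<partial>P) =
    (\<integral>\<omega>. h a (sample_path t \<beta> \<omega>) \<partial>P) * (\<integral>\<omega>. h b (sample_path t B\<^sub>2 \<omega>) * h c (sample_path t B\<^sub>3 \<omega>) \<partial>P)"
    using int[OF c\<beta>] indep_var_integrable[OF ind23] int[OF c2] int[OF c3]
    by (intro indep_var_lebesgue_integral[OF ind1]) (auto simp: comp_def)
  also have "(\<integral>\<omega>. h b (sample_path t B\<^sub>2 \<omega>) * h c (sample_path t B\<^sub>3 \<omega>) \<partial>P) =
    (\<integral>\<omega>. h b (sample_path t B\<^sub>2 \<omega>) \<partial>P) * (\<integral>\<omega>. h c (sample_path t B\<^sub>3 \<omega>) \<partial>P)"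
    using indep_var_lebesgue_integral[OF ind23] int[OF c2] int[OF c3] by (auto simp: comp_def)
  finally show ?thesis
    unfolding h_sp by (simp add: exp_add[symmetric] distrib_left add.assoc)
qed

section \<open>Rotation invariance of the bridge\<close>

definition vector_process :: "(real \<Rightarrow> 'a \<Rightarrow> real) \<Rightarrow> real \<Rightarrow> ('n::finite \<Rightarrow> 'a) \<Rightarrow> real^'n" where
  "vector_process \<beta> s \<omega> = (\<chi> k. \<beta> s (\<omega> k))"

abbreviation iid_copies :: "'a measure \<Rightarrow> ('n::finite \<Rightarrow> 'a) measure" where
  "iid_copies Q \<equiv> PiM UNIV (\<lambda>_. Q)"

lemma vector_process_measurable:
  assumes "\<beta> s \<in> borel_measurable Q"
  shows "(vector_process \<beta> s :: ('n::finite \<Rightarrow> 'a) \<Rightarrow> real^'n) \<in> borel_measurable (iid_copies Q)"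
  unfolding vector_process_def[abs_def]
  using assms by (intro borel_measurable_vec_lambda measurable_compose[OF measurable_component_singleton]) auto

lemma vector_bridge_iexp:
  fixes u :: "real \<Rightarrow> real^'n::finite"
  assumes bb: "brownian_bridge Q t 0 \<beta>" and J: "finite J" "J \<subseteq> {0..t}" and t: "0 < t"
  shows "(\<integral>\<omega>. iexp (\<Sum>s\<in>J. u s \<bullet> vector_process \<beta> s \<omega>) \<partial>iid_copies Q) =
    exp (- (\<Sum>s\<in>J. \<Sum>r\<in>J. (u s \<bullet> u r) * bridge_cov t s r) / 2)"
proof -
  interpret prob_space Q using bb by (simp add: brownian_bridge_def continuous_process_def)
  interpret product_sigma_finite "\<lambda>_::'n. Q" by standard
  have m: "\<beta> s \<in> borel_measurable Q" if "s \<in> J" for s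
    using bb J that by (auto simp: brownian_bridge_def continuous_process_def)
  have "(\<integral>\<omega>. iexp (\<Sum>s\<in>J. u s \<bullet> vector_process \<beta> s \<omega>) \<partial>iid_copies Q) =
     (\<integral>\<omega>. (\<Prod>k\<in>UNIV. iexp (\<Sum>s\<in>J. u s $ k * \<beta> s (\<omega> k))) \<partial>iid_copies Q)"
  proof (intro Bochner_Integration.integral_cong refl)
    fix \<omega> :: "'n \<Rightarrow> 'a"
    have "(\<Sum>s\<in>J. u s \<bullet> vector_process \<beta> s \<omega>) = (\<Sum>k\<in>UNIV. \<Sum>s\<in>J. u s $ k * \<beta> s (\<omega> k))"
      unfolding vector_process_def inner_vec_def by (simp add: sum.swap[of _ J])
    then show "iexp (\<Sum>s\<in>J. u s \<bullet> vector_process \<beta> s \<omega>) = (\<Prod>k\<in>UNIV. iexp (\<Sum>s\<in>J. u s $ k * \<beta> s (\<omega> k)))"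
      by (simp only: of_real_sum sum_distrib_left exp_sum[OF finite])
  qed
  also have "\<dots> = (\<Prod>k\<in>UNIV. \<integral>\<omega>. iexp (\<Sum>s\<in>J. u s $ k * \<beta> s \<omega>) \<partial>Q)"
  proof (rule product_integral_prod)
    show "integrable Q (\<lambda>\<omega>. iexp (\<Sum>s\<in>J. u s $ k * \<beta> s \<omega>))" for k
      using m by (intro integrable_bounded[of _ 1] borel_measurable_iexp borel_measurable_sum borel_measurable_times) auto
  qed simp
  also have "\<dots> = (\<Prod>k\<in>UNIV. complex_of_real (exp (- (\<Sum>s\<in>J. \<Sum>r\<in>J. u s $ k * u r $ k * bridge_cov t s r) / 2)))"
    using brownian_bridge_iexp[OF bb J t] by simp
  also have "\<dots> = exp (\<Sum>k\<in>UNIV. - (\<Sum>s\<in>J. \<Sum>r\<in>J. u s $ k * u r $ k * bridge_cov t s r) / 2)"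
    by (simp add: exp_sum)
  also have "(\<Sum>k\<in>UNIV. - (\<Sum>s\<in>J. \<Sum>r\<in>J. u s $ k * u r $ k * bridge_cov t s r) / 2) =
     - (\<Sum>k\<in>UNIV. \<Sum>s\<in>J. \<Sum>r\<in>J. u s $ k * u r $ k * bridge_cov t s r) / 2"
    by (simp add: sum_divide_distrib sum_negf)
  also have "(\<Sum>k\<in>UNIV. \<Sum>s\<in>J. \<Sum>r\<in>J. u s $ k * u r $ k * bridge_cov t s r) =
     (\<Sum>s\<in>J. \<Sum>r\<in>J. (u s \<bullet> u r) * bridge_cov t s r)"
    unfolding inner_vec_def sum_distrib_right
    by (subst sum.swap, intro sum.cong refl, subst sum.swap) simp
  finally show ?thesis .
qed

text \<open>
  The cylinder probabilities of \<open>|b + (s / t) v|\<close>, where \<open>b\<close> is an \<open>n\<close>-dimensional bridge from \<open>0\<close> to \<open>0\<close>; the process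
  inside the norm is a bridge from \<open>0\<close> to \<open>v\<close>.
\<close>

definition shifted_norm_box ::
    "'a measure \<Rightarrow> real \<Rightarrow> (real \<Rightarrow> 'a \<Rightarrow> real) \<Rightarrow> real set \<Rightarrow> (real \<Rightarrow> real set) \<Rightarrow> real^'n::finite \<Rightarrow> ennreal" where
  "shifted_norm_box Q t \<beta> J A v = emeasure (iid_copies Q)
     {\<omega> \<in> space (iid_copies Q). \<forall>s\<in>J. norm (vector_process \<beta> s \<omega> + (s / t) *\<^sub>R v) \<in> A s}"

text \<open>
  The law of the norm of a bridge from \<open>0\<close> to \<open>v\<close> depends on \<open>|v|\<close> only. An orthogonal map taking \<open>v\<close> to \<open>w\<close>
  preserves norms, and it preserves the law of \<open>b\<close> because the characteristic function of \<open>b\<close> involves the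
  frequencies only through their inner products.
\<close>

lemma shifted_norm_box_rotate:
  fixes v w :: "real^'n::finite"
  assumes bb: "brownian_bridge Q t 0 \<beta>" and J: "finite J" "J \<subseteq> {0..t}" and t: "0 < t"
    and [measurable]: "\<And>s. A s \<in> sets borel" and vw: "norm v = norm w"
  shows "shifted_norm_box Q t \<beta> J A v = shifted_norm_box Q t \<beta> J A w"
proof -
  obtain f where f: "orthogonal_transformation f" "f v = w"
    using orthogonal_transformation_exists[OF vw] .
  then have lin: "linear f" by (simp add: orthogonal_transformation_def)
  have pQ: "prob_space Q" using bb by (simp add: brownian_bridge_def continuous_process_def)
  have pR: "prob_space (iid_copies Q :: ('n \<Rightarrow> 'a) measure)" by (intro prob_space_PiM pQ)
  have m: "(vector_process \<beta> s :: _ \<Rightarrow> real^'n) \<in> borel_measurable (iid_copies Q)" if "s \<in> J" for s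
    using bb J that by (intro vector_process_measurable) (auto simp: brownian_bridge_def continuous_process_def)
  have "norm (vector_process \<beta> s \<omega> + (s / t) *\<^sub>R v) = norm (f (vector_process \<beta> s \<omega>) + (s / t) *\<^sub>R w)" for s and \<omega> :: "'n \<Rightarrow> 'a"
    using orthogonal_transformation_norm[OF f(1), of "vector_process \<beta> s \<omega> + (s / t) *\<^sub>R v"]
    by (simp add: linear_add[OF lin] linear_scale[OF lin] f(2))
  then have "shifted_norm_box Q t \<beta> J A v = emeasure (iid_copies Q)
     {\<omega> \<in> space (iid_copies Q). \<forall>s\<in>J. f (vector_process \<beta> s \<omega>) \<in> {y. norm (y + (s / t) *\<^sub>R w) \<in> A s}}"
    by (simp add: shifted_norm_box_def)
  also have "\<dots> = emeasure (iid_copies Q)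
     {\<omega> \<in> space (iid_copies Q). \<forall>s\<in>J. vector_process \<beta> s \<omega> \<in> {y. norm (y + (s / t) *\<^sub>R w) \<in> A s}}"
  proof (rule vector_char_unique[OF pR pR J(1)])
    fix u :: "real \<Rightarrow> real^'n"
    \<comment> \<open>Pulling the frequencies back along \<open>f\<close> moves \<open>f\<close> from the process to the frequencies.\<close>
    have "\<forall>s. \<exists>y. u s = f y" using orthogonal_transformation_surj[OF f(1)] by (metis surjD)
    then obtain u' where u': "u s = f (u' s)" for s by metis
    have inner: "f a \<bullet> f b = a \<bullet> b" for a b using f(1) by (simp add: orthogonal_transformation_def)
    show "(\<integral>\<omega>. iexp (\<Sum>s\<in>J. u s \<bullet> f (vector_process \<beta> s \<omega>)) \<partial>iid_copies Q) =
       (\<integral>\<omega>. iexp (\<Sum>s\<in>J. u s \<bullet> vector_process \<beta> s \<omega>) \<partial>iid_copies Q)"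
      using vector_bridge_iexp[OF bb J t, of u] vector_bridge_iexp[OF bb J t, of u'] by (simp add: u' inner)
  next
    have "f \<in> borel_measurable borel"
      using lin by (intro borel_measurable_continuous_onI linear_continuous_on) (simp add: linear_conv_bounded_linear)
    then show "(\<lambda>\<omega>. f (vector_process \<beta> s \<omega>)) \<in> borel_measurable (iid_copies Q)" if "s \<in> J" for s
      using m[OF that] by (rule measurable_compose[rotated])
    show "{y :: real^'n. norm (y + (s / t) *\<^sub>R w) \<in> A s} \<in> sets borel" for s
    proof -
      have "(\<lambda>y :: real^'n. norm (y + (s / t) *\<^sub>R w)) -` A s \<inter> space borel \<in> sets borel"
        by (intro measurable_sets[of _ _ borel]) auto
      then show ?thesis by (simp add: vimage_def)
    qed
  qed (use m in auto)
  finally show ?thesis by (simp add: shifted_norm_box_def)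
qed

lemma bridge_ends_at_zero:
  assumes bb: "brownian_bridge Q t 0 \<beta>" and t: "0 < t"
  shows "AE \<omega> in Q. \<beta> t \<omega> = 0"
proof -
  have m: "\<beta> t \<in> borel_measurable Q" and E: "integral\<^sup>L Q (\<beta> t) = 0" and c: "covariance Q (\<beta> t) (\<beta> t) = 0"
    and g: "gaussian_process Q t \<beta>"
    using bb t by (auto simp: brownian_bridge_def continuous_process_def)
  interpret prob_space Q using bb by (simp add: brownian_bridge_def continuous_process_def)
  have "gaussian_variable Q (\<lambda>\<omega>. \<Sum>r\<in>{t}. 1 * \<beta> r \<omega>)"
    using g t unfolding gaussian_process_def by (elim allE[of _ "{t}"] allE[of _ "\<lambda>_. 1"]) auto
  then have "integrable Q (\<lambda>\<omega>. (\<beta> t \<omega>)\<^sup>2)" using gaussian_variable_integrable_square by simp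
  moreover have "(\<integral>\<omega>. (\<beta> t \<omega>)\<^sup>2 \<partial>Q) = 0" using c E by (simp add: covariance_def power2_eq_square)
  ultimately show ?thesis by (simp add: integral_nonneg_eq_0_iff_AE)
qed

text \<open>
  At time \<open>t\<close> the bridge \<open>b\<close> is \<open>0\<close>, so the endpoint of \<open>|b + (s / t) v|\<close> is the deterministic number \<open>|v|\<close>. This makes
  conditioning on the endpoint a restriction of the range of \<open>|v|\<close>.
\<close>

lemma shifted_norm_box_endpoint:
  fixes v :: "real^'n::finite"
  assumes bb: "brownian_bridge Q t 0 \<beta>" and J: "finite J" "J \<subseteq> {0..t}" "t \<in> J" and t: "0 < t"
    and A[measurable]: "\<And>s. A s \<in> sets borel"
  shows "shifted_norm_box Q t \<beta> J (A(t := A t \<inter> {c..})) v = shifted_norm_box Q t \<beta> J A v * indicator {c..} (norm v)"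
proof -
  let ?R = "iid_copies Q :: ('n \<Rightarrow> 'a) measure"
  have pQ: "prob_space Q" using bb by (simp add: brownian_bridge_def continuous_process_def)
  have "AE \<omega> in ?R. \<beta> t (\<omega> k) = 0" for k
    using bridge_ends_at_zero[OF bb t] pQ by (intro AE_PiM_component[where P="\<lambda>\<omega>. \<beta> t \<omega> = 0"]) auto
  then have "AE \<omega> in ?R. \<forall>k. \<beta> t (\<omega> k) = 0" by (simp add: AE_all_countable)
  then have ae: "AE \<omega> in ?R. vector_process \<beta> t \<omega> = (0 :: real^'n)"
    by eventually_elim (simp add: vector_process_def vec_eq_iff)
  have m: "(vector_process \<beta> s :: _ \<Rightarrow> real^'n) \<in> borel_measurable ?R" if "s \<in> J" for s
    using bb J that by (intro vector_process_measurable) (auto simp: brownian_bridge_def continuous_process_def)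
  define N where "N s \<omega> = norm (vector_process \<beta> s \<omega> + (s / t) *\<^sub>R v)" for s \<omega>
  have box: "shifted_norm_box Q t \<beta> J B v = emeasure ?R {\<omega> \<in> space ?R. \<forall>s\<in>J. N s \<omega> \<in> B s}" for B
    unfolding shifted_norm_box_def N_def ..
  have S: "{\<omega> \<in> space ?R. \<forall>s\<in>J. N s \<omega> \<in> B s} \<in> sets ?R"
    if [measurable]: "\<And>s. B s \<in> sets borel" for B :: "real \<Rightarrow> real set"
  proof (intro sets.sets_Collect_finite_All J(1))
    fix s assume "s \<in> J"
    note [measurable] = m[OF this]
    show "{\<omega> \<in> space ?R. N s \<omega> \<in> B s} \<in> sets ?R" unfolding N_def by measurable
  qed
  have A': "(A(t := A t \<inter> {c..})) s \<in> sets borel" for s using A by simp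
  have aeN: "AE \<omega> in ?R. N t \<omega> = norm v"
    using ae by eventually_elim (use t in \<open>simp add: N_def\<close>)
  have upd: "(\<forall>s\<in>J. f s \<in> (A(t := A t \<inter> {c..})) s) \<longleftrightarrow> (\<forall>s\<in>J. f s \<in> A s) \<and> c \<le> f t" for f
  proof
    assume *: "\<forall>s\<in>J. f s \<in> (A(t := A t \<inter> {c..})) s"
    have "f s \<in> A s" if "s \<in> J" for s using *[rule_format, OF that] by (cases "s = t") simp_all
    moreover have "c \<le> f t" using *[rule_format, OF J(3)] by simp
    ultimately show "(\<forall>s\<in>J. f s \<in> A s) \<and> c \<le> f t" by blast
  qed simp
  show ?thesis
  proof (cases "c \<le> norm v")
    case True
    have "shifted_norm_box Q t \<beta> J (A(t := A t \<inter> {c..})) v = shifted_norm_box Q t \<beta> J A v"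
      unfolding box
    proof (rule emeasure_eq_AE[OF _ S[OF A'] S[OF A]])
      show "AE \<omega> in ?R. (\<omega> \<in> {\<omega> \<in> space ?R. \<forall>s\<in>J. N s \<omega> \<in> (A(t := A t \<inter> {c..})) s}) =
        (\<omega> \<in> {\<omega> \<in> space ?R. \<forall>s\<in>J. N s \<omega> \<in> A s})"
        using aeN unfolding upd by eventually_elim (simp add: True)
    qed
    then show ?thesis using True by simp
  next
    case False
    have "shifted_norm_box Q t \<beta> J (A(t := A t \<inter> {c..})) v = emeasure ?R {}"
      unfolding box
    proof (rule emeasure_eq_AE[OF _ S[OF A']])
      show "AE \<omega> in ?R. (\<omega> \<in> {\<omega> \<in> space ?R. \<forall>s\<in>J. N s \<omega> \<in> (A(t := A t \<inter> {c..})) s}) = (\<omega> \<in> {})"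
        using aeN unfolding upd by eventually_elim (simp add: False)
    qed simp
    then show ?thesis using False by simp
  qed
qed

section \<open>Lack of memory of planar Gaussian norms\<close>

lemma nn_integral_square_substitution:
  fixes k :: "real \<Rightarrow> ennreal"
  assumes [measurable]: "k \<in> borel_measurable borel"
  shows "(\<integral>\<^sup>+a. ennreal \<bar>a\<bar> * k (a\<^sup>2) \<partial>lborel) = (\<integral>\<^sup>+u. k u * indicator {0..} u \<partial>lborel)"
proof -
  have pos: "(\<integral>\<^sup>+a. k (a\<^sup>2) * ennreal (2 * a) * indicator {0..} a \<partial>lborel) = (\<integral>\<^sup>+u. k u * indicator {0..} u \<partial>lborel)"
  proof -
    have "(\<integral>\<^sup>+u. k u * indicator {0..} u \<partial>lborel) = (\<integral>\<^sup>+u. (SUP n. k u * indicator {0..(real (Suc n))\<^sup>2} u) \<partial>lborel)"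
    proof (intro nn_integral_cong)
      fix u :: real
      obtain n :: nat where n: "max 1 \<bar>u\<bar> \<le> real n" using real_arch_simple by blast
      moreover have "real n \<le> (real (Suc n))\<^sup>2"
        using of_nat_0_le_iff[of "n * n"] by (simp add: power2_eq_square algebra_simps)
      ultimately have "\<bar>u\<bar> \<le> (real (Suc n))\<^sup>2" by linarith
      then have *: "indicator {0..} u = (indicator {0..(real (Suc n))\<^sup>2} u :: ennreal)" by (auto simp: indicator_def)
      show "k u * indicator {0..} u = (SUP n. k u * indicator {0..(real (Suc n))\<^sup>2} u)"
      proof (rule antisym)
        show "k u * indicator {0..} u \<le> (SUP n. k u * indicator {0..(real (Suc n))\<^sup>2} u)"
          unfolding * by (rule SUP_upper) simp
      qed (auto intro!: SUP_least simp: indicator_def)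
    qed
    also have "\<dots> = (SUP n. \<integral>\<^sup>+u. k u * indicator {0..(real (Suc n))\<^sup>2} u \<partial>lborel)"
    proof (rule nn_integral_monotone_convergence_SUP)
      have "(real (Suc m))\<^sup>2 \<le> (real (Suc n))\<^sup>2" if "m \<le> n" for m n using that by (intro power_mono) auto
      then show "incseq (\<lambda>n u. k u * indicator {0..(real (Suc n))\<^sup>2} u)"
        unfolding incseq_def le_fun_def
        by (intro allI impI mult_left_mono indicator_leI) (auto simp del: of_nat_Suc intro: order_trans)
    qed measurable
    also have "\<dots> = (SUP n. \<integral>\<^sup>+a. k (a\<^sup>2) * ennreal (2 * a) * indicator {0..real (Suc n)} a \<partial>lborel)"
    proof (intro SUP_cong refl)
      fix n
      have "(\<integral>\<^sup>+u. k u * indicator {0\<^sup>2..(real (Suc n))\<^sup>2} u \<partial>lborel) =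
        (\<integral>\<^sup>+a. k (a\<^sup>2) * ennreal (2 * a) * indicator {0..real (Suc n)} a \<partial>lborel)"
        by (rule nn_integral_substitution_aux) (auto intro!: derivative_eq_intros continuous_intros)
      then show "(\<integral>\<^sup>+u. k u * indicator {0..(real (Suc n))\<^sup>2} u \<partial>lborel) =
        (\<integral>\<^sup>+a. k (a\<^sup>2) * ennreal (2 * a) * indicator {0..real (Suc n)} a \<partial>lborel)"
        by (simp only: zero_power2)
    qed
    also have "\<dots> = (\<integral>\<^sup>+a. (SUP n. k (a\<^sup>2) * ennreal (2 * a) * indicator {0..real (Suc n)} a) \<partial>lborel)"
    proof (rule nn_integral_monotone_convergence_SUP[symmetric])
      show "incseq (\<lambda>n a. k (a\<^sup>2) * ennreal (2 * a) * indicator {0..real (Suc n)} a)"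
        unfolding incseq_def le_fun_def
        by (intro allI impI mult_left_mono indicator_leI) auto
    qed measurable
    also have "\<dots> = (\<integral>\<^sup>+a. k (a\<^sup>2) * ennreal (2 * a) * indicator {0..} a \<partial>lborel)"
    proof (intro nn_integral_cong)
      fix a :: real
      obtain n :: nat where "a \<le> real n" using real_arch_simple by blast
      then have *: "indicator {0..} a = (indicator {0..real (Suc n)} a :: ennreal)" by (auto simp: indicator_def)
      show "(SUP n. k (a\<^sup>2) * ennreal (2 * a) * indicator {0..real (Suc n)} a) = k (a\<^sup>2) * ennreal (2 * a) * indicator {0..} a"
      proof (rule antisym)
        show "k (a\<^sup>2) * ennreal (2 * a) * indicator {0..} a \<le> (SUP n. k (a\<^sup>2) * ennreal (2 * a) * indicator {0..real (Suc n)} a)"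
          unfolding * by (rule SUP_upper) simp
      qed (auto intro!: SUP_least simp: indicator_def)
    qed
    finally show ?thesis ..
  qed
  let ?I = "\<integral>\<^sup>+a. ennreal \<bar>a\<bar> * k (a\<^sup>2) * indicator {0..} a \<partial>lborel"
  have "(\<integral>\<^sup>+a. ennreal \<bar>a\<bar> * k (a\<^sup>2) \<partial>lborel) =
    (\<integral>\<^sup>+a. ennreal \<bar>a\<bar> * k (a\<^sup>2) * indicator {0..} a + ennreal \<bar>a\<bar> * k (a\<^sup>2) * indicator {..<0} a \<partial>lborel)"
    by (intro nn_integral_cong) (auto simp: indicator_def)
  also have "\<dots> = ?I + (\<integral>\<^sup>+a. ennreal \<bar>a\<bar> * k (a\<^sup>2) * indicator {..<0} a \<partial>lborel)"
    by (intro nn_integral_add) auto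
  also have "(\<integral>\<^sup>+a. ennreal \<bar>a\<bar> * k (a\<^sup>2) * indicator {..<0} a \<partial>lborel) = ?I"
    by (subst nn_integral_real_affine[where c="-1" and t=0])
      (auto intro!: nn_integral_cong simp: indicator_def)
  also have "?I + ?I = (\<integral>\<^sup>+a. k (a\<^sup>2) * ennreal (2 * a) * indicator {0..} a \<partial>lborel)"
  proof -
    have "ennreal (2 * a) = ennreal \<bar>a\<bar> + ennreal \<bar>a\<bar>" if "0 \<le> a" for a :: real
      using that by (simp add: ennreal_plus[symmetric] del: ennreal_plus)
    then show ?thesis
      by (subst nn_integral_add[symmetric])
        (auto intro!: nn_integral_cong simp: indicator_def distrib_right mult.commute)
  qed
  finally show ?thesis using pos by simp
qed

text \<open>
  Polar integration without angles: for \<open>a \<noteq> 0\<close> substitute \<open>b = a s\<close>, so that the slope \<open>s\<close> plays the role of the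
  angle. The first factor on the right collects the slopes; its value \<open>\<pi>\<close> cancels wherever two such
  integrals are compared.
\<close>

lemma nn_integral_plane_radial:
  fixes h :: "real \<Rightarrow> ennreal"
  assumes [measurable]: "h \<in> borel_measurable borel"
  shows "(\<integral>\<^sup>+a. \<integral>\<^sup>+b. h (a\<^sup>2 + b\<^sup>2) \<partial>lborel \<partial>lborel) =
    (\<integral>\<^sup>+s. ennreal (1 / (1 + s\<^sup>2)) \<partial>lborel) * (\<integral>\<^sup>+u. h u * indicator {0..} u \<partial>lborel)"
proof -
  have "(\<integral>\<^sup>+a. \<integral>\<^sup>+b. h (a\<^sup>2 + b\<^sup>2) \<partial>lborel \<partial>lborel) =
    (\<integral>\<^sup>+a. \<integral>\<^sup>+s. ennreal \<bar>a\<bar> * h (a\<^sup>2 * (1 + s\<^sup>2)) \<partial>lborel \<partial>lborel)"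
  proof (rule nn_integral_cong_AE)
    have "AE a in lborel. (a::real) \<noteq> 0" by (rule AE_lborel_singleton)
    then show "AE a in lborel. (\<integral>\<^sup>+b. h (a\<^sup>2 + b\<^sup>2) \<partial>lborel) = (\<integral>\<^sup>+s. ennreal \<bar>a\<bar> * h (a\<^sup>2 * (1 + s\<^sup>2)) \<partial>lborel)"
    proof eventually_elim
      case (elim a)
      then show ?case
        by (subst nn_integral_real_affine[where c=a and t=0])
          (auto simp: nn_integral_cmult power_mult_distrib distrib_left)
    qed
  qed
  also have "\<dots> = (\<integral>\<^sup>+s. \<integral>\<^sup>+a. ennreal \<bar>a\<bar> * h (a\<^sup>2 * (1 + s\<^sup>2)) \<partial>lborel \<partial>lborel)"
    by (rule lborel_pair.Fubini') measurable
  also have "\<dots> = (\<integral>\<^sup>+s. ennreal (1 / (1 + s\<^sup>2)) * (\<integral>\<^sup>+u. h u * indicator {0..} u \<partial>lborel) \<partial>lborel)"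
  proof (intro nn_integral_cong)
    fix s :: real
    have s: "1 + s\<^sup>2 > 0" using zero_le_power2[of s] by linarith
    have "(\<integral>\<^sup>+a. ennreal \<bar>a\<bar> * h (a\<^sup>2 * (1 + s\<^sup>2)) \<partial>lborel) = (\<integral>\<^sup>+u. h (u * (1 + s\<^sup>2)) * indicator {0..} u \<partial>lborel)"
      by (rule nn_integral_square_substitution[of "\<lambda>u. h (u * (1 + s\<^sup>2))"]) measurable
    also have "\<dots> = ennreal (1 / (1 + s\<^sup>2)) * (\<integral>\<^sup>+u. h u * indicator {0..} u \<partial>lborel)"
      using s by (subst nn_integral_real_affine[where c="1 / (1 + s\<^sup>2)" and t=0])
        (auto intro!: arg_cong2[where f="(*)"] nn_integral_cong simp: indicator_def zero_le_divide_iff)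
    finally show "(\<integral>\<^sup>+a. ennreal \<bar>a\<bar> * h (a\<^sup>2 * (1 + s\<^sup>2)) \<partial>lborel) =
       ennreal (1 / (1 + s\<^sup>2)) * (\<integral>\<^sup>+u. h u * indicator {0..} u \<partial>lborel)" .
  qed
  also have "\<dots> = (\<integral>\<^sup>+s. ennreal (1 / (1 + s\<^sup>2)) \<partial>lborel) * (\<integral>\<^sup>+u. h u * indicator {0..} u \<partial>lborel)"
    by (rule nn_integral_multc) measurable
  finally show ?thesis .
qed

text \<open>
  For a planar Gaussian vector with independent components of variance \<open>t\<close> the squared norm \<open>R\<close> is exponentially
  distributed with mean \<open>2 t\<close>. Lack of memory says that \<open>R\<close>, restricted to \<open>R \<ge> x\<^sup>2\<close>, has the law of \<open>x\<^sup>2 + R\<close>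
  scaled by the tail probability \<open>exp (- x\<^sup>2 / (2 t))\<close>.
\<close>

lemma planar_gaussian_memoryless:
  fixes g :: "real \<Rightarrow> ennreal" and t x :: real
  assumes [measurable]: "g \<in> borel_measurable borel" and t: "0 < t"
  defines "N \<equiv> density lborel (normal_density 0 (sqrt t))"
  shows "(\<integral>\<^sup>+a. \<integral>\<^sup>+b. g (sqrt (a\<^sup>2 + b\<^sup>2)) * indicator {\<bar>x\<bar>..} (sqrt (a\<^sup>2 + b\<^sup>2)) \<partial>N \<partial>N) =
    ennreal (exp (- x\<^sup>2 / (2 * t))) * (\<integral>\<^sup>+a. \<integral>\<^sup>+b. g (sqrt (x\<^sup>2 + a\<^sup>2 + b\<^sup>2)) \<partial>N \<partial>N)"
proof -
  define \<kappa> where "\<kappa> = 1 / sqrt (2 * pi * t)"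
  \<comment> \<open>The density constant of \<open>R\<close>; it multiplies both sides, so its value is left unevaluated.\<close>
  define C where "C = ennreal (\<kappa>\<^sup>2) * (\<integral>\<^sup>+s. ennreal (1 / (1 + s\<^sup>2)) \<partial>lborel)"
  have polar: "(\<integral>\<^sup>+a. \<integral>\<^sup>+b. h (a\<^sup>2 + b\<^sup>2) \<partial>N \<partial>N) =
     C * (\<integral>\<^sup>+u. h u * ennreal (exp (- u / (2 * t))) * indicator {0..} u \<partial>lborel)"
    if [measurable]: "h \<in> borel_measurable borel" for h :: "real \<Rightarrow> ennreal"
  proof -
    have *: "normal_density 0 (sqrt t) a * normal_density 0 (sqrt t) b = \<kappa>\<^sup>2 * exp (- (a\<^sup>2 + b\<^sup>2) / (2 * t))" for a b
      using t by (simp add: normal_density_def \<kappa>_def power2_eq_square exp_add[symmetric] add_divide_distrib[symmetric] field_simps)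
    have "(\<integral>\<^sup>+a. \<integral>\<^sup>+b. h (a\<^sup>2 + b\<^sup>2) \<partial>N \<partial>N) =
      (\<integral>\<^sup>+a. \<integral>\<^sup>+b. ennreal (\<kappa>\<^sup>2) * (h (a\<^sup>2 + b\<^sup>2) * ennreal (exp (- (a\<^sup>2 + b\<^sup>2) / (2 * t)))) \<partial>lborel \<partial>lborel)"
    proof -
      have "ennreal (normal_density 0 (sqrt t) a) * (ennreal (normal_density 0 (sqrt t) b) * z) =
        ennreal (\<kappa>\<^sup>2) * (z * ennreal (exp (- (a\<^sup>2 + b\<^sup>2) / (2 * t))))" for a b z
        using arg_cong[OF *[of a b], of ennreal] by (simp add: ennreal_mult ac_simps)
      then show ?thesis
        unfolding N_def by (simp add: nn_integral_density nn_integral_cmult[symmetric])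
    qed
    also have "\<dots> = ennreal (\<kappa>\<^sup>2) * (\<integral>\<^sup>+a. \<integral>\<^sup>+b. h (a\<^sup>2 + b\<^sup>2) * ennreal (exp (- (a\<^sup>2 + b\<^sup>2) / (2 * t))) \<partial>lborel \<partial>lborel)"
      by (simp add: nn_integral_cmult)
    also have "(\<integral>\<^sup>+a. \<integral>\<^sup>+b. h (a\<^sup>2 + b\<^sup>2) * ennreal (exp (- (a\<^sup>2 + b\<^sup>2) / (2 * t))) \<partial>lborel \<partial>lborel) =
      (\<integral>\<^sup>+s. ennreal (1 / (1 + s\<^sup>2)) \<partial>lborel) * (\<integral>\<^sup>+u. h u * ennreal (exp (- u / (2 * t))) * indicator {0..} u \<partial>lborel)"
      by (rule nn_integral_plane_radial[of "\<lambda>u. h u * ennreal (exp (- u / (2 * t)))"]) measurable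
    finally show ?thesis by (simp add: C_def mult.assoc)
  qed
  have "(\<integral>\<^sup>+a. \<integral>\<^sup>+b. g (sqrt (a\<^sup>2 + b\<^sup>2)) * indicator {\<bar>x\<bar>..} (sqrt (a\<^sup>2 + b\<^sup>2)) \<partial>N \<partial>N) =
     C * (\<integral>\<^sup>+u. g (sqrt u) * indicator {\<bar>x\<bar>..} (sqrt u) * ennreal (exp (- u / (2 * t))) * indicator {0..} u \<partial>lborel)"
    by (rule polar[of "\<lambda>u. g (sqrt u) * indicator {\<bar>x\<bar>..} (sqrt u)"]) measurable
  also have "(\<integral>\<^sup>+u. g (sqrt u) * indicator {\<bar>x\<bar>..} (sqrt u) * ennreal (exp (- u / (2 * t))) * indicator {0..} u \<partial>lborel) =
    (\<integral>\<^sup>+u. g (sqrt (x\<^sup>2 + u)) * ennreal (exp (- (x\<^sup>2 + u) / (2 * t))) * indicator {0..} u \<partial>lborel)"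
  proof -
    have shift: "(\<integral>\<^sup>+u. k u \<partial>lborel) = (\<integral>\<^sup>+u. k (x\<^sup>2 + u) \<partial>lborel)"
      if "k \<in> borel_measurable borel" for k :: "real \<Rightarrow> ennreal"
      using nn_integral_real_affine[OF that, of 1 "x\<^sup>2"] by simp
    have "(\<integral>\<^sup>+u. g (sqrt u) * indicator {\<bar>x\<bar>..} (sqrt u) * ennreal (exp (- u / (2 * t))) * indicator {0..} u \<partial>lborel) =
      (\<integral>\<^sup>+u. g (sqrt (x\<^sup>2 + u)) * indicator {\<bar>x\<bar>..} (sqrt (x\<^sup>2 + u)) * ennreal (exp (- (x\<^sup>2 + u) / (2 * t)))
        * indicator {0..} (x\<^sup>2 + u) \<partial>lborel)"
      by (rule shift) measurable
    also have "\<dots> = (\<integral>\<^sup>+u. g (sqrt (x\<^sup>2 + u)) * ennreal (exp (- (x\<^sup>2 + u) / (2 * t))) * indicator {0..} u \<partial>lborel)"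
    proof (intro nn_integral_cong)
    fix u :: real
    have "\<bar>x\<bar> \<le> sqrt (x\<^sup>2 + u) \<and> 0 \<le> x\<^sup>2 + u \<longleftrightarrow> 0 \<le> u"
    proof -
      have "\<bar>x\<bar> = sqrt (x\<^sup>2)" by simp
      then have "\<bar>x\<bar> \<le> sqrt (x\<^sup>2 + u) \<longleftrightarrow> x\<^sup>2 \<le> x\<^sup>2 + u" by (simp only: real_sqrt_le_iff)
      then show ?thesis using zero_le_power2[of x] by linarith
    qed
    then show "g (sqrt (x\<^sup>2 + u)) * indicator {\<bar>x\<bar>..} (sqrt (x\<^sup>2 + u)) * ennreal (exp (- (x\<^sup>2 + u) / (2 * t))) * indicator {0..} (x\<^sup>2 + u) =
        g (sqrt (x\<^sup>2 + u)) * ennreal (exp (- (x\<^sup>2 + u) / (2 * t))) * indicator {0..} u"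
        by (auto simp: indicator_def)
    qed
    finally show ?thesis .
  qed
  also have "\<dots> = (\<integral>\<^sup>+u. ennreal (exp (- x\<^sup>2 / (2 * t))) * (g (sqrt (x\<^sup>2 + u)) * ennreal (exp (- u / (2 * t))) * indicator {0..} u) \<partial>lborel)"
  proof -
    have "exp (- (x\<^sup>2 + u) / (2 * t)) = exp (- x\<^sup>2 / (2 * t)) * exp (- u / (2 * t))" for u
      by (simp add: exp_add[symmetric] add_divide_distrib diff_divide_distrib)
    then show ?thesis by (simp only: ennreal_mult exp_ge_zero ac_simps)
  qed
  also have "\<dots> = ennreal (exp (- x\<^sup>2 / (2 * t))) * (\<integral>\<^sup>+u. g (sqrt (x\<^sup>2 + u)) * ennreal (exp (- u / (2 * t))) * indicator {0..} u \<partial>lborel)"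
    by (rule nn_integral_cmult) measurable
  also have "C * \<dots> = ennreal (exp (- x\<^sup>2 / (2 * t))) * (C * (\<integral>\<^sup>+u. g (sqrt (x\<^sup>2 + u)) * ennreal (exp (- u / (2 * t))) * indicator {0..} u \<partial>lborel))"
    by (simp only: ac_simps)
  also have "C * (\<integral>\<^sup>+u. g (sqrt (x\<^sup>2 + u)) * ennreal (exp (- u / (2 * t))) * indicator {0..} u \<partial>lborel) =
     (\<integral>\<^sup>+a. \<integral>\<^sup>+b. g (sqrt (x\<^sup>2 + (a\<^sup>2 + b\<^sup>2))) \<partial>N \<partial>N)"
    by (rule polar[of "\<lambda>u. g (sqrt (x\<^sup>2 + u))", symmetric]) measurable
  finally show ?thesis by (simp only: add.assoc)
qed

section \<open>The radial process conditioned on its endpoint\<close>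

lemma integral_pair_mult:
  fixes f :: "'a \<Rightarrow> complex" and g :: "'b \<Rightarrow> complex"
  assumes "prob_space M1" "prob_space M2"
    and [measurable]: "f \<in> borel_measurable M1" "g \<in> borel_measurable M2"
    and bound: "\<And>x. norm (f x) \<le> 1" "\<And>y. norm (g y) \<le> 1"
  shows "(\<integral>z. f (fst z) * g (snd z) \<partial>(M1 \<Otimes>\<^sub>M M2)) = (\<integral>x. f x \<partial>M1) * (\<integral>y. g y \<partial>M2)"
proof -
  interpret M1: prob_space M1 by fact
  interpret M2: prob_space M2 by fact
  interpret pair_prob_space M1 M2 ..
  have "integrable (M1 \<Otimes>\<^sub>M M2) (\<lambda>z. f (fst z) * g (snd z))"
    by (rule integrable_bounded[of _ 1]) (auto simp: norm_mult intro!: mult_le_one bound)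
  from integral_fst'[OF this] show ?thesis by simp
qed

text \<open>
  A Brownian motion is a bridge from \<open>0\<close> to \<open>0\<close> plus \<open>(s / t) Z\<close> with \<open>Z\<close> independent and normal of variance \<open>t\<close>, and
  a bridge to \<open>x\<close> is a bridge to \<open>0\<close> plus \<open>(s / t) x\<close>. Hence \<open>(\<beta>, B\<^sub>2, B\<^sub>3)\<close> has the law of
  \<open>b + (s / t) (x, Z\<^sub>2, Z\<^sub>3)\<close> with \<open>b\<close> a three-dimensional bridge independent of \<open>(Z\<^sub>2, Z\<^sub>3)\<close>. The right-hand side is this
  law, disintegrated over the values \<open>(a, b)\<close> of \<open>(Z\<^sub>2, Z\<^sub>3)\<close>; the identity is checked on characteristic functions.
\<close>

lemma bridge_with_planar_motion_box:
  fixes t x :: real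
  assumes t: "0 < t" and bb0: "brownian_bridge Q t 0 \<beta>\<^sub>0"
    and bb: "brownian_bridge P t x \<beta>" and bm: "brownian_motion_2d P t B\<^sub>2 B\<^sub>3"
    and ind: "indep_of_pair P t \<beta> B\<^sub>2 B\<^sub>3"
    and J: "finite J" "J \<subseteq> {0..t}" and A: "\<And>s. A s \<in> sets borel"
  defines "N \<equiv> density lborel (normal_density 0 (sqrt t))"
  shows "emeasure P {\<omega> \<in> space P. \<forall>s\<in>J. sqrt ((\<beta> s \<omega>)\<^sup>2 + (B\<^sub>2 s \<omega>)\<^sup>2 + (B\<^sub>3 s \<omega>)\<^sup>2) \<in> A s} =
    (\<integral>\<^sup>+a. \<integral>\<^sup>+b. shifted_norm_box Q t \<beta>\<^sub>0 J A (vector [x, a, b] :: real^3) \<partial>N \<partial>N)"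
proof -
  have pP: "prob_space P" using bb by (simp add: brownian_bridge_def continuous_process_def)
  have pQ: "prob_space Q" using bb0 by (simp add: brownian_bridge_def continuous_process_def)
  have c\<beta>: "continuous_process P t \<beta>" using bb by (simp add: brownian_bridge_def)
  have bm2: "brownian_motion P t B\<^sub>2" and bm3: "brownian_motion P t B\<^sub>3"
    using bm by (auto simp: brownian_motion_2d_def)
  have mP: "\<beta> s \<in> borel_measurable P" "B\<^sub>2 s \<in> borel_measurable P" "B\<^sub>3 s \<in> borel_measurable P" if "s \<in> J" for s
    using that J c\<beta> bm2 bm3 by (auto simp: brownian_motion_def continuous_process_def)
  let ?R = "iid_copies Q :: (3 \<Rightarrow> _) measure"
  have pR: "prob_space ?R" by (intro prob_space_PiM pQ)
  have pN: "prob_space N" unfolding N_def using t by (intro prob_space_normal_density) simp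
  have pNN: "prob_space (N \<Otimes>\<^sub>M N)" by (intro prob_space_pair pN)
  have pD: "prob_space ((N \<Otimes>\<^sub>M N) \<Otimes>\<^sub>M ?R)" by (intro prob_space_pair pNN pR)
  interpret R: prob_space ?R by fact
  interpret N: prob_space N by fact
  have sets_N[measurable_cong]: "sets N = sets borel" and space_N: "space N = UNIV" by (simp_all add: N_def)
  have mV: "(vector_process \<beta>\<^sub>0 s :: _ \<Rightarrow> real^3) \<in> borel_measurable ?R" if "s \<in> J" for s
    using bb0 J that by (intro vector_process_measurable) (auto simp: brownian_bridge_def continuous_process_def)
  have m3: "(\<lambda>x. vector [f x, g x, h x] :: real^3) \<in> borel_measurable M"
    if [measurable]: "f \<in> borel_measurable M" "g \<in> borel_measurable M" "h \<in> borel_measurable M"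
    for f g h and M :: "'c measure"
  proof -
    have "(\<lambda>x. (vector [f x, g x, h x] :: real^3) $ k) \<in> borel_measurable M" for k :: 3
      using exhaust_3[of k] that by (auto simp: vector_3)
    then have "(\<lambda>x. \<chi> k. (vector [f x, g x, h x] :: real^3) $ k) \<in> borel_measurable M"
      by (rule borel_measurable_vec_lambda)
    then show ?thesis by (simp only: vec_lambda_eta)
  qed
  define W :: "real \<Rightarrow> _ \<Rightarrow> real^3" where "W s \<omega> = vector [\<beta> s \<omega>, B\<^sub>2 s \<omega>, B\<^sub>3 s \<omega>]" for s \<omega>
  define V :: "real \<Rightarrow> _ \<Rightarrow> real^3" where
    "V s z = vector_process \<beta>\<^sub>0 s (snd z) + (s / t) *\<^sub>R vector [x, fst (fst z), snd (fst z)]" for s z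
  have mW: "W s \<in> borel_measurable P" if "s \<in> J" for s
    unfolding W_def[abs_def] using mP[OF that] by (rule m3)
  have mV': "V s \<in> borel_measurable ((N \<Otimes>\<^sub>M N) \<Otimes>\<^sub>M ?R)" if "s \<in> J" for s
    unfolding V_def[abs_def]
    by (intro borel_measurable_add borel_measurable_scaleR m3 measurable_compose[OF measurable_snd mV[OF that]]) measurable
  have iexp_N: "(\<integral>a. iexp (p * a) \<partial>N) = exp (- (p\<^sup>2 * t / 2))" for p
  proof -
    have "distr N lborel (\<lambda>a. a) = N" by (rule distr_id2) (simp add: N_def)
    then have "distributed N lborel (\<lambda>a. a) (normal_density 0 (sqrt t))"
      unfolding distributed_def by (simp add: N_def)
    from N.iexp_normal[OF this, of p] t show ?thesis by simp
  qed
  \<comment> \<open>Both characteristic functions are expressed through the quadratic forms \<open>q\<close> and the linear form \<open>l\<close>.\<close>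
  define q where "q K c = (\<Sum>s\<in>J. \<Sum>r\<in>J. c s * c r * K s r)" for K :: "real \<Rightarrow> real \<Rightarrow> real" and c
  define l where "l c = (\<Sum>s\<in>J. c s * (s / t))" for c :: "real \<Rightarrow> real"
  have q_min: "q min c = q (bridge_cov t) c + (l c)\<^sup>2 * t" for c
  proof -
    have "(l c)\<^sup>2 * t = (\<Sum>s\<in>J. \<Sum>r\<in>J. c s * c r * (s * r / t))"
    proof -
      have "(l c)\<^sup>2 * t = (\<Sum>s\<in>J. \<Sum>r\<in>J. (c s * (s / t)) * (c r * (r / t))) * t"
        by (simp only: l_def power2_eq_square sum_product)
      also have "\<dots> = (\<Sum>s\<in>J. \<Sum>r\<in>J. (c s * (s / t)) * (c r * (r / t)) * t)"
        by (simp only: sum_distrib_right)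
      also have "\<dots> = (\<Sum>s\<in>J. \<Sum>r\<in>J. c s * c r * (s * r / t))"
        using t by (intro sum.cong refl) (simp add: field_simps)
      finally show ?thesis .
    qed
    moreover have "q min c = (\<Sum>s\<in>J. \<Sum>r\<in>J. c s * c r * bridge_cov t s r + c s * c r * (s * r / t))"
      unfolding q_def bridge_cov_def by (intro sum.cong refl) (simp add: right_diff_distrib)
    ultimately show ?thesis by (simp only: q_def sum.distrib)
  qed
  have "emeasure P {\<omega> \<in> space P. \<forall>s\<in>J. W s \<omega> \<in> norm -` A s} =
    emeasure ((N \<Otimes>\<^sub>M N) \<Otimes>\<^sub>M ?R) {z \<in> space ((N \<Otimes>\<^sub>M N) \<Otimes>\<^sub>M ?R). \<forall>s\<in>J. V s z \<in> norm -` A s}"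
  proof (rule vector_char_unique[OF pP pD J(1) mW mV'])
    show "norm -` A s \<in> sets (borel :: (real^3) measure)" for s
    proof -
      have "(norm :: real^3 \<Rightarrow> real) \<in> borel_measurable borel" by measurable
      from measurable_sets[OF this A] show ?thesis by simp
    qed
  next
    fix u :: "real \<Rightarrow> real^3"
    define c where "c k s = u s $ k" for k s
    have cW: "(\<Sum>s\<in>J. u s \<bullet> W s \<omega>) =
      (\<Sum>s\<in>J. c 1 s * \<beta> s \<omega>) + (\<Sum>s\<in>J. c 2 s * B\<^sub>2 s \<omega>) + (\<Sum>s\<in>J. c 3 s * B\<^sub>3 s \<omega>)" for \<omega>
      by (simp add: W_def inner_vec_def sum_3 vector_3 c_def sum.distrib)
    have "(\<integral>\<omega>. iexp (\<Sum>s\<in>J. u s \<bullet> W s \<omega>) \<partial>P) =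
      (iexp (l (c 1) * x) * exp (- q (bridge_cov t) (c 1) / 2)) *
      (exp (- q min (c 2) / 2) * exp (- q min (c 3) / 2))"
    proof -
      have "(\<Sum>s\<in>J. c 1 s * (s / t * x)) = l (c 1) * x"
        unfolding l_def sum_distrib_right by (simp add: mult.assoc)
      then show ?thesis
        unfolding cW bridge_planar_motion_iexp[OF bm ind c\<beta> J] brownian_bridge_iexp[OF bb J t]
          brownian_motion_iexp[OF bm2 J t] brownian_motion_iexp[OF bm3 J t]
        by (simp add: q_def)
    qed
    also have "\<dots> = iexp (l (c 1) * x) * (exp (- ((l (c 2))\<^sup>2 * t / 2)) * exp (- ((l (c 3))\<^sup>2 * t / 2))) *
       exp (- (q (bridge_cov t) (c 1) + q (bridge_cov t) (c 2) + q (bridge_cov t) (c 3)) / 2)"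
    proof -
      have "exp (- q (bridge_cov t) (c 1) / 2) * (exp (- q min (c 2) / 2) * exp (- q min (c 3) / 2)) =
        exp (- ((l (c 2))\<^sup>2 * t / 2)) * exp (- ((l (c 3))\<^sup>2 * t / 2)) *
        exp (- (q (bridge_cov t) (c 1) + q (bridge_cov t) (c 2) + q (bridge_cov t) (c 3)) / 2)"
        unfolding q_min exp_add[symmetric] by (intro arg_cong[where f=exp]) (simp add: field_simps)
      from arg_cong[OF this, of complex_of_real] show ?thesis by (simp only: of_real_mult mult.assoc)
    qed
    also have "\<dots> = (\<integral>z. iexp (\<Sum>s\<in>J. u s \<bullet> V s z) \<partial>((N \<Otimes>\<^sub>M N) \<Otimes>\<^sub>M ?R))"
    proof -
      have cV: "(\<Sum>s\<in>J. u s \<bullet> V s z) = l (c 1) * x + (l (c 2) * fst (fst z) + l (c 3) * snd (fst z))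
         + (\<Sum>s\<in>J. u s \<bullet> vector_process \<beta>\<^sub>0 s (snd z))" for z
        by (simp add: V_def inner_add_right sum.distrib inner_vec_def[of _ "vector _"] sum_3 vector_3 c_def l_def
            sum_distrib_left sum_distrib_right algebra_simps)
      have qs: "(\<Sum>s\<in>J. \<Sum>r\<in>J. (u s \<bullet> u r) * bridge_cov t s r) =
        q (bridge_cov t) (c 1) + q (bridge_cov t) (c 2) + q (bridge_cov t) (c 3)"
        by (simp add: q_def inner_vec_def sum_3 c_def distrib_right sum.distrib)
      have "(\<integral>z. iexp (\<Sum>s\<in>J. u s \<bullet> V s z) \<partial>((N \<Otimes>\<^sub>M N) \<Otimes>\<^sub>M ?R)) =
        (\<integral>z. iexp (l (c 1) * x) * ((iexp (l (c 2) * fst (fst z)) * iexp (l (c 3) * snd (fst z))) *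
           iexp (\<Sum>s\<in>J. u s \<bullet> vector_process \<beta>\<^sub>0 s (snd z))) \<partial>((N \<Otimes>\<^sub>M N) \<Otimes>\<^sub>M ?R))"
        unfolding cV by (simp only: of_real_add distrib_left exp_add mult.assoc)
      also have "\<dots> = iexp (l (c 1) * x) * (\<integral>z. (iexp (l (c 2) * fst (fst z)) * iexp (l (c 3) * snd (fst z))) *
           iexp (\<Sum>s\<in>J. u s \<bullet> vector_process \<beta>\<^sub>0 s (snd z)) \<partial>((N \<Otimes>\<^sub>M N) \<Otimes>\<^sub>M ?R))"
        by (rule integral_mult_right_zero)
      also have "(\<integral>z. (iexp (l (c 2) * fst (fst z)) * iexp (l (c 3) * snd (fst z))) *
           iexp (\<Sum>s\<in>J. u s \<bullet> vector_process \<beta>\<^sub>0 s (snd z)) \<partial>((N \<Otimes>\<^sub>M N) \<Otimes>\<^sub>M ?R)) =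
         (\<integral>y. iexp (l (c 2) * fst y) * iexp (l (c 3) * snd y) \<partial>(N \<Otimes>\<^sub>M N)) *
         (\<integral>\<omega>. iexp (\<Sum>s\<in>J. u s \<bullet> vector_process \<beta>\<^sub>0 s \<omega>) \<partial>?R)"
      proof (rule integral_pair_mult[OF pNN pR, where f="\<lambda>y. iexp (l (c 2) * fst y) * iexp (l (c 3) * snd y)"])
        show "(\<lambda>\<omega>. iexp (\<Sum>s\<in>J. u s \<bullet> vector_process \<beta>\<^sub>0 s \<omega>)) \<in> borel_measurable ?R"
          by (intro borel_measurable_iexp borel_measurable_sum borel_measurable_inner mV) auto
        show "(\<lambda>y. iexp (l (c 2) * fst y) * iexp (l (c 3) * snd y)) \<in> borel_measurable (N \<Otimes>\<^sub>M N)"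
          by (intro borel_measurable_iexp borel_measurable_times) measurable
      qed (simp_all only: norm_mult norm_exp_i_times mult_1 order_refl)
      also have "(\<integral>y. iexp (l (c 2) * fst y) * iexp (l (c 3) * snd y) \<partial>(N \<Otimes>\<^sub>M N)) =
         (\<integral>a. iexp (l (c 2) * a) \<partial>N) * (\<integral>b. iexp (l (c 3) * b) \<partial>N)"
      proof (rule integral_pair_mult[OF pN pN])
        show "(\<lambda>a. iexp (p * a)) \<in> borel_measurable N" for p
          by (intro borel_measurable_iexp) measurable
        then show "(\<lambda>a. iexp (l (c 3) * a)) \<in> borel_measurable N" .
      qed (simp_all only: norm_exp_i_times order_refl)
      finally show ?thesis
        unfolding iexp_N vector_bridge_iexp[OF bb0 J t] qs by (simp only: of_real_mult mult.assoc)
    qed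
    finally show "(\<integral>\<omega>. iexp (\<Sum>s\<in>J. u s \<bullet> W s \<omega>) \<partial>P) = (\<integral>z. iexp (\<Sum>s\<in>J. u s \<bullet> V s z) \<partial>((N \<Otimes>\<^sub>M N) \<Otimes>\<^sub>M ?R))" .
  qed
  also have "{\<omega> \<in> space P. \<forall>s\<in>J. W s \<omega> \<in> norm -` A s} =
     {\<omega> \<in> space P. \<forall>s\<in>J. sqrt ((\<beta> s \<omega>)\<^sup>2 + (B\<^sub>2 s \<omega>)\<^sup>2 + (B\<^sub>3 s \<omega>)\<^sup>2) \<in> A s}"
    by (simp add: W_def norm_vec_def L2_set_def sum_3 vector_3)
  also have "emeasure ((N \<Otimes>\<^sub>M N) \<Otimes>\<^sub>M ?R) {z \<in> space ((N \<Otimes>\<^sub>M N) \<Otimes>\<^sub>M ?R). \<forall>s\<in>J. V s z \<in> norm -` A s} =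
    (\<integral>\<^sup>+a. \<integral>\<^sup>+b. shifted_norm_box Q t \<beta>\<^sub>0 J A (vector [x, a, b] :: real^3) \<partial>N \<partial>N)"
  proof -
    let ?S = "{z \<in> space ((N \<Otimes>\<^sub>M N) \<Otimes>\<^sub>M ?R). \<forall>s\<in>J. V s z \<in> norm -` A s}"
    have S: "?S \<in> sets ((N \<Otimes>\<^sub>M N) \<Otimes>\<^sub>M ?R)"
    proof (intro sets.sets_Collect_finite_All J(1))
      fix s assume "s \<in> J"
      note [measurable] = mV'[OF this] and A[measurable]
      have "{z \<in> space ((N \<Otimes>\<^sub>M N) \<Otimes>\<^sub>M ?R). norm (V s z) \<in> A s} \<in> sets ((N \<Otimes>\<^sub>M N) \<Otimes>\<^sub>M ?R)" by measurable
      then show "{z \<in> space ((N \<Otimes>\<^sub>M N) \<Otimes>\<^sub>M ?R). V s z \<in> norm -` A s} \<in> sets ((N \<Otimes>\<^sub>M N) \<Otimes>\<^sub>M ?R)" by simp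
    qed
    have "emeasure ?R (Pair y -` ?S) = shifted_norm_box Q t \<beta>\<^sub>0 J A (vector [x, fst y, snd y] :: real^3)" for y
      unfolding shifted_norm_box_def
      by (intro arg_cong2[where f=emeasure] refl) (auto simp: V_def space_pair_measure space_N)
    then show ?thesis
      using R.emeasure_pair_measure_alt[OF S] N.nn_integral_fst[OF R.measurable_emeasure_Pair[OF S]] by simp
  qed
  finally show ?thesis .
qed


text \<open>
  By rotation invariance the endpoint \<open>(x, a, b)\<close> may be moved to the first axis. On the right-hand side \<open>x\<close>
  then enters only through the distance \<open>sqrt (x\<^sup>2 + a\<^sup>2 + b\<^sup>2)\<close>, and the same bridge serves all \<open>x\<close>.
\<close>

lemma radial_box_law:
  fixes t x :: real
  assumes t: "0 < t" and bb0: "brownian_bridge Q t 0 \<beta>\<^sub>0"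
    and bb: "brownian_bridge P t x \<beta>" and bm: "brownian_motion_2d P t B\<^sub>2 B\<^sub>3"
    and ind: "indep_of_pair P t \<beta> B\<^sub>2 B\<^sub>3"
    and J: "finite J" "J \<subseteq> {0..t}" and A: "\<And>s. A s \<in> sets borel"
  defines "N \<equiv> density lborel (normal_density 0 (sqrt t))"
  shows "emeasure P {\<omega> \<in> space P. \<forall>s\<in>J. sqrt ((\<beta> s \<omega>)\<^sup>2 + (B\<^sub>2 s \<omega>)\<^sup>2 + (B\<^sub>3 s \<omega>)\<^sup>2) \<in> A s} =
    (\<integral>\<^sup>+a. \<integral>\<^sup>+b. shifted_norm_box Q t \<beta>\<^sub>0 J A (sqrt (x\<^sup>2 + a\<^sup>2 + b\<^sup>2) *\<^sub>R axis 1 1 :: real^3) \<partial>N \<partial>N)"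
proof -
  have "shifted_norm_box Q t \<beta>\<^sub>0 J A (vector [x, a, b] :: real^3) =
    shifted_norm_box Q t \<beta>\<^sub>0 J A (sqrt (x\<^sup>2 + a\<^sup>2 + b\<^sup>2) *\<^sub>R axis 1 1 :: real^3)" for a b
  proof (rule shifted_norm_box_rotate[OF bb0 J t A])
    show "norm (vector [x, a, b] :: real^3) = norm (sqrt (x\<^sup>2 + a\<^sup>2 + b\<^sup>2) *\<^sub>R axis 1 1 :: real^3)"
      by (simp add: norm_vec_def[of "vector _"] L2_set_def sum_3 vector_3)
  qed
  then show ?thesis
    using bridge_with_planar_motion_box[OF t bb0 bb bm ind J, of A] A unfolding N_def by simp
qed

lemma shifted_norm_box_radial_measurable:
  assumes bb: "brownian_bridge Q t 0 \<beta>" and J: "finite J" "J \<subseteq> {0..t}" and A: "\<And>s. A s \<in> sets borel"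
  shows "(\<lambda>r. shifted_norm_box Q t \<beta> J A (r *\<^sub>R v :: real^'n::finite)) \<in> borel_measurable borel"
proof -
  let ?R = "iid_copies Q :: ('n \<Rightarrow> _) measure"
  have pQ: "prob_space Q" using bb by (simp add: brownian_bridge_def continuous_process_def)
  interpret R: prob_space ?R by (intro prob_space_PiM pQ)
  let ?S = "{z \<in> space (borel \<Otimes>\<^sub>M ?R). \<forall>s\<in>J. norm (vector_process \<beta> s (snd z) + (s / t) *\<^sub>R (fst z *\<^sub>R v)) \<in> A s}"
  have S: "?S \<in> sets (borel \<Otimes>\<^sub>M ?R)"
  proof (intro sets.sets_Collect_finite_All J(1))
    fix s assume "s \<in> J"
    then have [measurable]: "(vector_process \<beta> s :: _ \<Rightarrow> real^'n) \<in> borel_measurable ?R"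
      using bb J by (intro vector_process_measurable) (auto simp: brownian_bridge_def continuous_process_def)
    note A[measurable]
    show "{z \<in> space (borel \<Otimes>\<^sub>M ?R). norm (vector_process \<beta> s (snd z) + (s / t) *\<^sub>R (fst z *\<^sub>R v)) \<in> A s} \<in> sets (borel \<Otimes>\<^sub>M ?R)"
      by measurable
  qed
  have "emeasure ?R (Pair r -` ?S) = shifted_norm_box Q t \<beta> J A (r *\<^sub>R v)" for r
    unfolding shifted_norm_box_def
    by (intro arg_cong2[where f=emeasure] refl) (auto simp: space_pair_measure)
  with R.measurable_emeasure_Pair[OF S] show ?thesis by simp
qed

theorem corollary1p4:
  fixes t :: real
    and Q :: "real \<Rightarrow> 'b measure"
    and \<beta> B\<^sub>2 B\<^sub>3 :: "real \<Rightarrow> real \<Rightarrow> 'b \<Rightarrow> real"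
    and P :: "real \<Rightarrow> 'a measure"
    and M :: "real \<Rightarrow> real \<Rightarrow> 'a \<Rightarrow> real"
    and x :: real
    and F :: "(real \<Rightarrow> real) \<Rightarrow> ennreal"
  assumes "0 < t"
    and "\<And>y. brownian_bridge (Q y) t y (\<beta> y)"
    and "\<And>y. brownian_motion_2d (Q y) t (B\<^sub>2 y) (B\<^sub>3 y)"
    and "\<And>y. indep_of_pair (Q y) t (\<beta> y) (B\<^sub>2 y) (B\<^sub>3 y)"
    and "\<And>y. continuous_process (P y) t (M y)"
    and "\<And>y. path_law (P y) t (M y) =
           path_law (Q y) t (\<lambda>s \<omega>. sqrt ((\<beta> y s \<omega>)\<^sup>2 + (B\<^sub>2 y s \<omega>)\<^sup>2 + (B\<^sub>3 y s \<omega>)\<^sup>2))"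
    and "F \<in> borel_measurable (path_borel t)"
  shows "(\<integral>\<^sup>+ \<omega>. F (sample_path t (M x) \<omega>) \<partial>P x) =
           cond_nn_expectation (P 0) (\<lambda>\<omega>. F (sample_path t (M 0) \<omega>)) {\<omega> \<in> space (P 0). \<bar>x\<bar> \<le> M 0 t \<omega>}"
proof -
  note t = assms(1) and bb = assms(2) and bm = assms(3) and ind = assms(4)
    and cM = assms(5) and law = assms(6) and F = assms(7)
  have t0: "0 \<le> t" using t by simp
  define \<rho> where "\<rho> y s \<omega> = sqrt ((\<beta> y s \<omega>)\<^sup>2 + (B\<^sub>2 y s \<omega>)\<^sup>2 + (B\<^sub>3 y s \<omega>)\<^sup>2)" for y s \<omega>
  define \<mu> where "\<mu> y = path_law (P y) t (M y)" for y
  have \<mu>_\<rho>: "\<mu> y = path_law (Q y) t (\<rho> y)" for y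
    unfolding \<mu>_def law \<rho>_def ..
  have c\<rho>: "continuous_process (Q y) t (\<rho> y)" for y
    unfolding continuous_process_def
  proof (intro conjI ballI)
    note c = bb[of y, unfolded brownian_bridge_def, THEN conjunct1]
      bm[of y, unfolded brownian_motion_2d_def brownian_motion_def, THEN conjunct1, THEN conjunct1]
      bm[of y, unfolded brownian_motion_2d_def brownian_motion_def, THEN conjunct2, THEN conjunct1, THEN conjunct1]
    note c = c[unfolded continuous_process_def]
    show "prob_space (Q y)" using c by blast
    show "\<rho> y s \<in> borel_measurable (Q y)" if "s \<in> {0..t}" for s
    proof -
      have [measurable]: "\<beta> y s \<in> borel_measurable (Q y)" "B\<^sub>2 y s \<in> borel_measurable (Q y)"
        "B\<^sub>3 y s \<in> borel_measurable (Q y)" using c that by blast+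
      show ?thesis unfolding \<rho>_def[abs_def] by measurable
    qed
    show "continuous_on {0..t} (\<lambda>s. \<rho> y s \<omega>)" if "\<omega> \<in> space (Q y)" for \<omega>
      unfolding \<rho>_def using c that by (intro continuous_intros) blast+
  qed
  note sp = measurable_sample_path[OF cM t0] and sp\<rho> = measurable_sample_path[OF c\<rho> t0]
  have sets_\<mu>: "sets (\<mu> y) = sets (path_borel t)" and space_\<mu>: "space (\<mu> y) = space (path_borel t)" for y
    by (simp_all add: \<mu>_def path_law_def)
  have prob_\<mu>: "prob_space (\<mu> y)" for y
    unfolding \<mu>_def path_law_def using cM sp
    by (intro prob_space.prob_space_distr) (auto simp: continuous_process_def)
  have box_sets: "{f \<in> space (path_borel t). \<forall>s\<in>J. f s \<in> A s} \<in> sets (path_borel t)"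
    if "finite J" "J \<subseteq> {0..t}" "\<And>s. A s \<in> sets borel" for J and A :: "real \<Rightarrow> real set"
  proof (intro sets.sets_Collect_finite_All that(1))
    fix s assume "s \<in> J"
    then have "s \<in> {0..t}" using that by auto
    from measurable_sets[OF measurable_path_eval[OF this] that(3)]
    show "{f \<in> space (path_borel t). f s \<in> A s} \<in> sets (path_borel t)"
      by (simp add: vimage_def Int_def conj_commute)
  qed
  define N where "N = density lborel (normal_density 0 (sqrt t))"
  define G where "G J A r = shifted_norm_box (Q 0) t (\<beta> 0) J A (r *\<^sub>R axis 1 1 :: real^3)" for J A r
  have box: "emeasure (\<mu> y) {f \<in> space (path_borel t). \<forall>s\<in>J. f s \<in> A s} =
      (\<integral>\<^sup>+a. \<integral>\<^sup>+b. G J A (sqrt (y\<^sup>2 + a\<^sup>2 + b\<^sup>2)) \<partial>N \<partial>N)"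
    if "finite J" "J \<subseteq> {0..t}" "\<And>s. A s \<in> sets borel" for J A y
  proof -
    have "emeasure (\<mu> y) {f \<in> space (path_borel t). \<forall>s\<in>J. f s \<in> A s} =
      emeasure (Q y) (sample_path t (\<rho> y) -` {f \<in> space (path_borel t). \<forall>s\<in>J. f s \<in> A s} \<inter> space (Q y))"
      unfolding \<mu>_\<rho> path_law_def using box_sets[OF that] sp\<rho> by (intro emeasure_distr) auto
    also have "sample_path t (\<rho> y) -` {f \<in> space (path_borel t). \<forall>s\<in>J. f s \<in> A s} \<inter> space (Q y) =
      {\<omega> \<in> space (Q y). \<forall>s\<in>J. \<rho> y s \<omega> \<in> A s}"
    proof -
      have "sample_path t (\<rho> y) \<omega> s = \<rho> y s \<omega>" if "s \<in> J" for s \<omega>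
        using that \<open>J \<subseteq> {0..t}\<close> by (auto simp: sample_path_def)
      then show ?thesis using measurable_space[OF sp\<rho>] by auto
    qed
    finally show ?thesis
      using radial_box_law[OF t bb[of 0] bb[of y] bm ind that] by (simp add: \<rho>_def G_def N_def)
  qed
  define c where "c = ennreal (exp (- x\<^sup>2 / (2 * t)))"
  have c: "c \<noteq> 0" "c \<noteq> \<top>" by (simp_all add: c_def)
  define E where "E = {f \<in> space (path_borel t). \<bar>x\<bar> \<le> f t}"
  have E_sets: "E \<in> sets (\<mu> 0)"
    using box_sets[of "{t}" "\<lambda>_. {\<bar>x\<bar>..}"] t0 by (simp add: E_def sets_\<mu>)
  \<comment> \<open>The event \<open>E\<close> only shrinks the constraint at the endpoint, which belongs to \<open>J\<close>.\<close>
  have tilt: "emeasure (\<mu> 0) (E \<inter> {f \<in> space (path_borel t). \<forall>s\<in>J. f s \<in> A s}) =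
     c * emeasure (\<mu> x) {f \<in> space (path_borel t). \<forall>s\<in>J. f s \<in> A s}"
    if J: "finite J" "J \<subseteq> {0..t}" "t \<in> J" and A: "\<And>s. A s \<in> sets borel" for J and A :: "real \<Rightarrow> real set"
  proof -
    let ?A = "A(t := A t \<inter> {\<bar>x\<bar>..})"
    have A': "?A s \<in> sets borel" for s using A by simp
    have "E \<inter> {f \<in> space (path_borel t). \<forall>s\<in>J. f s \<in> A s} = {f \<in> space (path_borel t). \<forall>s\<in>J. f s \<in> ?A s}"
      using J(3) by (auto simp: E_def split: if_splits)
    then have "emeasure (\<mu> 0) (E \<inter> {f \<in> space (path_borel t). \<forall>s\<in>J. f s \<in> A s}) =
       (\<integral>\<^sup>+a. \<integral>\<^sup>+b. G J ?A (sqrt (a\<^sup>2 + b\<^sup>2)) \<partial>N \<partial>N)"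
      by (simp only: box[OF J(1,2) A', of 0] zero_power2 add_0)
    also have "\<dots> = (\<integral>\<^sup>+a. \<integral>\<^sup>+b. G J A (sqrt (a\<^sup>2 + b\<^sup>2)) * indicator {\<bar>x\<bar>..} (sqrt (a\<^sup>2 + b\<^sup>2)) \<partial>N \<partial>N)"
    proof -
      have "G J ?A r = G J A r * indicator {\<bar>x\<bar>..} r" if "0 \<le> r" for r
        unfolding G_def
        using shifted_norm_box_endpoint[where v="r *\<^sub>R axis 1 1 :: real^3" and A=A, OF bb[of 0] J t A, of "\<bar>x\<bar>"] that
        by (simp only: norm_scaleR norm_axis_1 abs_of_nonneg mult_1_right real_norm_def)
      then show ?thesis by simp
    qed
    also have "\<dots> = c * (\<integral>\<^sup>+a. \<integral>\<^sup>+b. G J A (sqrt (x\<^sup>2 + a\<^sup>2 + b\<^sup>2)) \<partial>N \<partial>N)"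
      unfolding c_def N_def G_def
      by (rule planar_gaussian_memoryless[OF shifted_norm_box_radial_measurable[OF bb J(1,2) A] t])
    finally show ?thesis using box[OF J(1,2) A, of x] by simp
  qed
  \<comment> \<open>The trivial cylinder gives the probability of the conditioning event itself.\<close>
  have E_c: "emeasure (\<mu> 0) E = c"
    using tilt[of "{t}" "\<lambda>_. UNIV"] t0 prob_space.emeasure_space_1[OF prob_\<mu>[of x]]
    by (simp add: space_\<mu> E_def Int_absorb2 subset_iff)
  have \<mu>_x: "\<mu> x = uniform_measure (\<mu> 0) E"
  proof (rule path_measure_eqI[OF t0])
    show "finite_measure (\<mu> x)" using prob_\<mu> by (rule prob_space.finite_measure)
    fix J and A :: "real \<Rightarrow> real set" assume J: "finite J" "J \<subseteq> {0..t}" "t \<in> J" and A: "\<And>s. A s \<in> sets borel"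
    show "emeasure (\<mu> x) {f \<in> space (path_borel t). \<forall>s\<in>J. f s \<in> A s} =
       emeasure (uniform_measure (\<mu> 0) E) {f \<in> space (path_borel t). \<forall>s\<in>J. f s \<in> A s}"
    proof -
      let ?S = "{f \<in> space (path_borel t). \<forall>s\<in>J. f s \<in> A s}"
      have "?S \<in> sets (\<mu> 0)" unfolding sets_\<mu> using J(1,2) A by (rule box_sets)
      then have "emeasure (uniform_measure (\<mu> 0) E) ?S = emeasure (\<mu> 0) (E \<inter> ?S) / c"
        using E_sets by (simp add: E_c)
      also have "emeasure (\<mu> 0) (E \<inter> ?S) = c * emeasure (\<mu> x) ?S" using J A by (rule tilt)
      also have "c * emeasure (\<mu> x) ?S / c = emeasure (\<mu> x) ?S"
        using mult_divide_eq_ennreal[OF c, of "emeasure (\<mu> x) ?S"] by (simp only: mult.commute[of c])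
      finally show ?thesis by simp
    qed
  qed (simp_all add: sets_\<mu>)
  let ?E = "{\<omega> \<in> space (P 0). \<bar>x\<bar> \<le> M 0 t \<omega>}"
  have F\<mu>: "F \<in> borel_measurable (\<mu> y)" for y using F sets_\<mu> by (simp cong: measurable_cong_sets)
  have Mt: "M 0 t \<in> borel_measurable (P 0)" using cM[of 0] t0 by (auto simp: continuous_process_def)
  have pre: "sample_path t (M 0) -` E \<inter> space (P 0) = ?E"
    using measurable_space[OF sp[of 0]] t0 by (auto simp: E_def sample_path_def)
  have "(\<integral>\<^sup>+ \<omega>. F (sample_path t (M x) \<omega>) \<partial>P x) = (\<integral>\<^sup>+ f. F f \<partial>\<mu> x)"
    unfolding \<mu>_def path_law_def using sp F by (intro nn_integral_distr[symmetric]) simp_all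
  also have "\<dots> = (\<integral>\<^sup>+ f. F f * indicator E f \<partial>\<mu> 0) / emeasure (\<mu> 0) E"
    unfolding \<mu>_x by (rule nn_integral_uniform_measure[OF F\<mu> E_sets])
  also have "emeasure (\<mu> 0) E = emeasure (P 0) ?E"
    using E_sets sp[of 0] pre by (simp add: \<mu>_def path_law_def emeasure_distr)
  also have "(\<integral>\<^sup>+ f. F f * indicator E f \<partial>\<mu> 0) =
      (\<integral>\<^sup>+ \<omega>. F (sample_path t (M 0) \<omega>) * indicator E (sample_path t (M 0) \<omega>) \<partial>P 0)"
    unfolding \<mu>_def path_law_def using sp F E_sets
    by (intro nn_integral_distr) (auto simp: sets_\<mu>)
  also have "\<dots> = (\<integral>\<^sup>+ \<omega>. F (sample_path t (M 0) \<omega>) * indicator ?E \<omega> \<partial>P 0)"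
    unfolding pre[symmetric] by (intro nn_integral_cong) (auto simp: indicator_def)
  also have "\<dots> / emeasure (P 0) ?E = cond_nn_expectation (P 0) (\<lambda>\<omega>. F (sample_path t (M 0) \<omega>)) ?E"
    unfolding cond_nn_expectation_def
    using measurable_compose[OF sp F] Mt by (intro nn_integral_uniform_measure[symmetric]) auto
  finally show ?thesis .
qed

end
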